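(* Consider a non-barotropic fluid with energy $\rho=\tilde\rho(n,s)$ and pressure $p=\tilde p(n,s)=n\,\partial_n\tilde\rho(n,s)-\tilde\rho(n,s)$ that is of van der Waals type at a given value $s_*$ of the specific entropy. Then there is a non-trivial one-parameter family $$\left((\underline n,\underline U^0,\underline U^1)(m),\ (\overline n,\overline U^0,\overline U^1)(m)\right),\qquad 0\le m<\bar m,$$ of pairs of non-identical states such that for every value of the parameter $m$ the Euler–Korteweg system $$\bar T^{\alpha\beta}{}_{,\beta}=0,\qquad N^\beta{}_{,\beta}=0,$$ $$\bar T^{\alpha\beta}=\bar\rho\,U^\alpha U^\beta+\bar p\,\Pi^{\alpha\beta}+\kappa\, n^{,\alpha}n^{,\beta},\qquad N^\beta=nU^\beta,$$ has two heteroclinic solutions $(n,s,U^0,U^1,U^2,U^3)$ depending only on $x^1$, $$x^1\mapsto(\overrightarrow n_m(x^1),s_*,\overrightarrow U^0_m(x^1),\overrightarrow U^1_m(x^1),0,0),\qquad x^1\mapsto(\overleftarrow n_m(x^1),s_*,\overleftarrow U^0_m(x^1),\overleftarrow U^1_m(x^1),0,0),$$ with $$(\overrightarrow n_m,\overrightarrow U^0_m,\overrightarrow U^1_m)(-\infty)=(\underline n,\underline U^0,\underline U^1)(m),\qquad(\overrightarrow n_m,\overrightarrow U^0_m,\overrightarrow U^1_m)(+\infty)=(\overline n,\overline U^0,\overline U^1)(m),$$ and $$(\overleftarrow n_m,\overleftarrow U^0_m,\overleftarrow U^1_m)(-\infty)=(\overline n,\overline U^0,\overline U^1)(m),\qquad(\overleftarrow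 n_m,\overleftarrow U^0_m,\overleftarrow U^1_m)(+\infty)=(\underline n,\underline U^0,\underline U^1)(m).$$
   Context: Space-time is Minkowski space with metric $g=\mathrm{diag}(-1,1,1,1)$; Greek indices run over $0,1,2,3$, are raised and lowered with $g$, repeated indices are summed, and $_{,\beta}$ denotes $\partial/\partial x^\beta$. The unknowns are the particle number density $n>0$, the specific entropy $s$, and the 4-velocity $U^\alpha$ with $U^\alpha U_\alpha=-1$ (and $U^0>0$); $\Pi^{\alpha\beta}=g^{\alpha\beta}+U^\alpha U^\beta$. The energy $\tilde\rho(n,s)$ and the capillarity coefficient $\kappa(n,s)>0$ are smooth functions. Extended energy and extended pressure: $$\bar\rho(n,\partial n,s)=\tilde\rho(n,s)+\tfrac12\kappa(n,s)n_{,\gamma}n^{,\gamma},\qquad \bar p(n,\partial n,\partial^2n,s)=n\,\frac{\delta\bar\rho}{\delta n}-\bar\rho,\qquad \frac{\delta\bar\rho}{\delta n}=\frac{\partial\bar\rho}{\partial n}-\left(\frac{\partial\bar\rho}{\partial n_{,\gamma}}\right)_{,\gamma}.$$ Put $r(n)=\tilde\rho(n,s_* )$ for $n\in(0,\infty)$. The fluid is of van der Waals type at $s_*$ if $r>0$, $n r'(n)>r(n)$, and the second derivative $r''(n)$ changes sign first from positive to negative and then from negative to positive as $n$ varies from $0$ to $\infty$; i.e. there are $n_B>n_A>0$ with $r''>0$ on $(0,n_A)$ and on $(n_B,\infty)$ and $r''<0$ on $(n_A,n_B)$. Solutions are smooth; heteroclinic means that the solution converges for $x^1\to\pm\infty$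 to end states that differ from each other, and values at $\pm\infty$ denote these limits.
   Formalization: Adds the assumption that at some density above n_B the pressure at s_* is again at least its local maximum p(n_A) (true if pressure is unbounded); without it, if the pressure rises too little beyond n_B, no equal-area pair and no heteroclinic solution need exist. *)

theory Defs
  imports "HOL-Analysis.Analysis"
begin

section \<open>Smooth functions\<close>

text \<open>On an open set \<open>S\<close> the predicate \<open>Ck_on k S f\<close> says that \<open>f\<close> is of class \<open>C\<^sup>k\<close>.\<close>

primrec Ck_on :: "nat \<Rightarrow> 'a::euclidean_space set \<Rightarrow> ('a \<Rightarrow> real) \<Rightarrow> bool" where
  "Ck_on 0 S f \<longleftrightarrow> continuous_on S f"
| "Ck_on (Suc k) S f \<longleftrightarrow>
     f differentiable_on S \<and> (\<forall>b\<in>Basis. Ck_on k S (\<lambda>x. frechet_derivative f (at x) b))"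

definition smooth_on :: "'a::euclidean_space set \<Rightarrow> ('a \<Rightarrow> real) \<Rightarrow> bool" where
  "smooth_on S f \<longleftrightarrow> (\<forall>k. Ck_on k S f)"


section \<open>Minkowski space\<close>

text \<open>Space-time is \<^typ>\<open>real ^ 4\<close>. The index type \<^typ>\<open>4\<close> is the integers modulo 4, so that its
  elements are exactly the Greek indices \<open>0, 1, 2, 3\<close>. The metric is its own inverse, hence
  \<open>mink\<close> both lowers and raises indices.\<close>

definition mink :: "4 \<Rightarrow> 4 \<Rightarrow> real" where
  "mink \<alpha> \<beta> = (if \<alpha> = \<beta> then (if \<alpha> = 0 then -1 else 1) else 0)"

definition mink_dot :: "real ^ 4 \<Rightarrow> real ^ 4 \<Rightarrow> real" where
  "mink_dot v w = (\<Sum>\<alpha>\<in>UNIV. \<Sum>\<beta>\<in>UNIV. mink \<alpha> \<beta> * v $ \<alpha> * w $ \<beta>)"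

definition raise :: "real ^ 4 \<Rightarrow> real ^ 4" where
  "raise v = (\<chi> \<alpha>. \<Sum>\<beta>\<in>UNIV. mink \<alpha> \<beta> * v $ \<beta>)"

definition pd :: "4 \<Rightarrow> (real ^ 4 \<Rightarrow> real) \<Rightarrow> real ^ 4 \<Rightarrow> real" where
  "pd \<beta> f x = frechet_derivative f (at x) (axis \<beta> 1)"

definition grad :: "(real ^ 4 \<Rightarrow> real) \<Rightarrow> real ^ 4 \<Rightarrow> real ^ 4" where
  "grad f x = (\<chi> \<beta>. pd \<beta> f x)"


section \<open>The Euler--Korteweg system\<close>

text \<open>Throughout, \<open>\<rho>\<close> and \<open>\<kappa>\<close> are functions of \<open>(n, s)\<close>, relevant for \<open>n > 0\<close> only.\<close>

definition pressure :: "(real \<Rightarrow> real \<Rightarrow> real) \<Rightarrow> real \<Rightarrow> real \<Rightarrow> real" where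
  "pressure \<rho> n s = n * deriv (\<lambda>\<nu>. \<rho> \<nu> s) n - \<rho> n s"

text \<open>In \<open>rho_bar \<rho> \<kappa> \<nu> v \<sigma>\<close> the argument \<open>v\<close> stands for the covector \<open>n\<^bsub>,\<gamma>\<^esub>\<close>.\<close>

definition rho_bar ::
    "(real \<Rightarrow> real \<Rightarrow> real) \<Rightarrow> (real \<Rightarrow> real \<Rightarrow> real) \<Rightarrow> real \<Rightarrow> real ^ 4 \<Rightarrow> real \<Rightarrow> real" where
  "rho_bar \<rho> \<kappa> \<nu> v \<sigma> = \<rho> \<nu> \<sigma> + 1/2 * \<kappa> \<nu> \<sigma> * (\<Sum>\<gamma>\<in>UNIV. v $ \<gamma> * raise v $ \<gamma>)"

definition var_deriv ::
    "(real \<Rightarrow> real \<Rightarrow> real) \<Rightarrow> (real \<Rightarrow> real \<Rightarrow> real)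
      \<Rightarrow> (real ^ 4 \<Rightarrow> real) \<Rightarrow> (real ^ 4 \<Rightarrow> real) \<Rightarrow> real ^ 4 \<Rightarrow> real" where
  "var_deriv \<rho> \<kappa> n s x =
     deriv (\<lambda>\<nu>. rho_bar \<rho> \<kappa> \<nu> (grad n x) (s x)) (n x)
     - (\<Sum>\<gamma>\<in>UNIV. pd \<gamma>
          (\<lambda>y. frechet_derivative (\<lambda>v. rho_bar \<rho> \<kappa> (n y) v (s y)) (at (grad n y)) (axis \<gamma> 1)) x)"

definition p_bar ::
    "(real \<Rightarrow> real \<Rightarrow> real) \<Rightarrow> (real \<Rightarrow> real \<Rightarrow> real)
      \<Rightarrow> (real ^ 4 \<Rightarrow> real) \<Rightarrow> (real ^ 4 \<Rightarrow> real) \<Rightarrow> real ^ 4 \<Rightarrow> real" where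
  "p_bar \<rho> \<kappa> n s x = n x * var_deriv \<rho> \<kappa> n s x - rho_bar \<rho> \<kappa> (n x) (grad n x) (s x)"

definition T_bar ::
    "(real \<Rightarrow> real \<Rightarrow> real) \<Rightarrow> (real \<Rightarrow> real \<Rightarrow> real)
      \<Rightarrow> (real ^ 4 \<Rightarrow> real) \<Rightarrow> (real ^ 4 \<Rightarrow> real) \<Rightarrow> (real ^ 4 \<Rightarrow> real ^ 4)
      \<Rightarrow> 4 \<Rightarrow> 4 \<Rightarrow> real ^ 4 \<Rightarrow> real" where
  "T_bar \<rho> \<kappa> n s U \<alpha> \<beta> x =
     rho_bar \<rho> \<kappa> (n x) (grad n x) (s x) * U x $ \<alpha> * U x $ \<beta>
     + p_bar \<rho> \<kappa> n s x * (mink \<alpha> \<beta> + U x $ \<alpha> * U x $ \<beta>)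
     + \<kappa> (n x) (s x) * raise (grad n x) $ \<alpha> * raise (grad n x) $ \<beta>"

definition euler_korteweg_solution ::
    "(real \<Rightarrow> real \<Rightarrow> real) \<Rightarrow> (real \<Rightarrow> real \<Rightarrow> real)
      \<Rightarrow> (real ^ 4 \<Rightarrow> real) \<Rightarrow> (real ^ 4 \<Rightarrow> real) \<Rightarrow> (real ^ 4 \<Rightarrow> real ^ 4) \<Rightarrow> bool" where
  "euler_korteweg_solution \<rho> \<kappa> n s U \<longleftrightarrow>
     smooth_on UNIV n \<and> smooth_on UNIV s \<and> (\<forall>\<alpha>. smooth_on UNIV (\<lambda>x. U x $ \<alpha>)) \<and>
     (\<forall>x. n x > 0 \<and> mink_dot (U x) (U x) = -1 \<and> U x $ 0 > 0) \<and>
     (\<forall>x \<alpha>. (\<Sum>\<beta>\<in>UNIV. pd \<beta> (T_bar \<rho> \<kappa> n s U \<alpha> \<beta>) x) = 0) \<and>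
     (\<forall>x. (\<Sum>\<beta>\<in>UNIV. pd \<beta> (\<lambda>y. n y * U y $ \<beta>) x) = 0)"


section \<open>Plane heteroclinic solutions\<close>

definition planar :: "real \<Rightarrow> real \<Rightarrow> real ^ 4" where
  "planar u0 u1 = (\<chi> \<alpha>. if \<alpha> = 0 then u0 else if \<alpha> = 1 then u1 else 0)"

text \<open>A triple \<open>(n, U\<^sup>0, U\<^sup>1)\<close>; the transverse velocity components are zero.\<close>

type_synonym state = "real \<times> real \<times> real"

definition admissible_state :: "state \<Rightarrow> bool" where
  "admissible_state = (\<lambda>(n, u0, u1). n > 0 \<and> u0 > 0 \<and> mink_dot (planar u0 u1) (planar u0 u1) = -1)"

text \<open>A profile maps \<open>x\<^sup>1\<close> to \<open>(n, U\<^sup>0, U\<^sup>1)\<close>.\<close>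

definition heteroclinic ::
    "(real \<Rightarrow> real \<Rightarrow> real) \<Rightarrow> (real \<Rightarrow> real \<Rightarrow> real) \<Rightarrow> real
      \<Rightarrow> state \<Rightarrow> state \<Rightarrow> (real \<Rightarrow> state) \<Rightarrow> bool" where
  "heteroclinic \<rho> \<kappa> s a b w \<longleftrightarrow>
     euler_korteweg_solution \<rho> \<kappa> (\<lambda>x. fst (w (x $ 1))) (\<lambda>x. s)
       (\<lambda>x. planar (fst (snd (w (x $ 1)))) (snd (snd (w (x $ 1))))) \<and>
     (w \<longlongrightarrow> a) at_bot \<and> (w \<longlongrightarrow> b) at_top \<and> a \<noteq> b"


section \<open>Fluids of van der Waals type\<close>

definition van_der_Waals_type :: "(real \<Rightarrow> real \<Rightarrow> real) \<Rightarrow> real \<Rightarrow> bool" where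
  "van_der_Waals_type \<rho> s \<longleftrightarrow>
     (let r = (\<lambda>n. \<rho> n s) in
       (\<forall>n>0. r n > 0 \<and> n * deriv r n > r n) \<and>
       (\<exists>nA nB. 0 < nA \<and> nA < nB \<and>
          (\<forall>n. 0 < n \<and> n < nA \<longrightarrow> deriv (deriv r) n > 0) \<and>
          (\<forall>n. nA < n \<and> n < nB \<longrightarrow> deriv (deriv r) n < 0) \<and>
          (\<forall>n>nB. deriv (deriv r) n > 0)))"

text \<open>A van der Waals pressure increases on \<open>(0, n\<^sub>A)\<close>, decreases on \<open>(n\<^sub>A, n\<^sub>B)\<close> and increases on
  \<open>(n\<^sub>B, \<infinity>)\<close>. The following condition says that at some density \<open>N > n\<^sub>B\<close> it is again at least
  its local maximum value \<open>p(n\<^sub>A)\<close>; it holds in particular if the pressure is unbounded. It is not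
  part of van der Waals type as defined above, and it cannot be dropped: if the pressure at infinity
  only barely exceeds \<open>p(n\<^sub>B)\<close>, then there is no equal-area pair of states, for any mass flux.\<close>

definition pressure_recovers :: "(real \<Rightarrow> real \<Rightarrow> real) \<Rightarrow> real \<Rightarrow> bool" where
  "pressure_recovers \<rho> s \<longleftrightarrow>
     (\<exists>N>0. \<forall>n>0. deriv (deriv (\<lambda>\<nu>. \<rho> \<nu> s)) n < 0 \<longrightarrow> n < N \<and> pressure \<rho> n s \<le> pressure \<rho> N s)"

end

theory Submission
  imports Defs
begin

text \<open>A plane stationary flow has constant flux \<open>m = n U\<^sup>1\<close>, and the two remaining momentum
  equations integrate to the scalar energy equation \<open>\<kappa> n'\<^sup>2 / 2 = F(n)\<close> with
  \<open>F(n) = r(n) - c sqrt (n\<^sup>2 + m\<^sup>2) + d\<close>. A heteroclinic orbit between \<open>a\<close> and \<open>b\<close>, in either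
  direction, exists if \<open>F\<close> has double zeros at \<open>a\<close> and \<open>b\<close> and is positive in between: time
  \<open>\<integral> sqrt (\<kappa> / (2 F)) dn\<close> diverges at both ends. At \<open>m = 0\<close> this is the double tangent of \<open>r\<close>
  (Maxwell's construction), found by varying the common pressure of the two states; it persists for
  small \<open>m\<close> because the tangency points lie where \<open>r'' > 0\<close>.\<close>


section \<open>Smooth functions of one real variable\<close>

text \<open>The levels available to Maxwell's construction run from the local minimum
  \<open>p B\<close> of the pressure to its local maximum \<open>p A\<close>. The first is attained
  at low density because \<open>r > 0\<close> and \<open>p B > 0\<close>; the second is attained
  beyond \<open>B\<close> by \<open>pressure_recovers\<close>. At these two extreme levels the
  difference of the chemical potentials has opposite signs, so it vanishes at a level in between.
  The obstacle in passing to \<open>m > 0\<close> is that \<open>F\<close> vanishes at its two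
  moving tangency points, so compactness alone cannot keep it positive between them. Near the
  tangency points positivity comes instead from strict monotonicity of \<mu>, on neighbourhoods that
  do not depend on \<open>m\<close>; compactness is left with the middle piece, where
  \<open>F\<close> at \<open>m = 0\<close> is bounded away from zero. At \<open>m = 0\<close> the
  component \<open>T\<^sup>0\<^sup>1\<close> vanishes whatever \<open>c\<close> is; the value of
  \<open>c\<close> is then imposed by tangency alone. The energy equation contains the sign of
  \<open>n'\<close> only through its square, which is why one pair of states carries orbits in both
  directions with the same flux.\<close>

primrec C_real :: "nat \<Rightarrow> real set \<Rightarrow> (real \<Rightarrow> real) \<Rightarrow> bool" where
  "C_real 0 S f \<longleftrightarrow> continuous_on S f"
| "C_real (Suc k) S f \<longleftrightarrow> (\<exists>f'. (\<forall>x\<in>S. (f has_real_derivative f' x) (at x)) \<and> C_real k S f')"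

definition smooth_real :: "real set \<Rightarrow> (real \<Rightarrow> real) \<Rightarrow> bool" where
  "smooth_real S f \<longleftrightarrow> (\<forall>k. C_real k S f)"

lemma C_real_SucI:
  "\<forall>x\<in>S. (f has_real_derivative f' x) (at x) \<Longrightarrow> C_real k S f' \<Longrightarrow> C_real (Suc k) S f"
  by auto

lemma C_real_cong:
  assumes "open S" "\<And>x. x \<in> S \<Longrightarrow> f x = g x" "C_real k S f"
  shows "C_real k S g"
proof (cases k)
  case 0
  then show ?thesis using assms by (simp cong: continuous_on_cong)
next
  case (Suc j)
  then obtain f' where f': "\<forall>x\<in>S. (f has_real_derivative f' x) (at x)" "C_real j S f'"
    using assms(3) by auto
  have "(g has_real_derivative f' x) (at x)" if "x \<in> S" for x
  proof -
    have "eventually (\<lambda>y. f y = g y) (nhds x)"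
      using eventually_nhds_in_open[OF assms(1) that] assms(2) by (rule eventually_mono)
    then show ?thesis using DERIV_cong_ev[OF refl _ refl] f'(1) that by blast
  qed
  with f' Suc show ?thesis by auto
qed

lemma C_real_Suc_D: "C_real (Suc k) S f \<Longrightarrow> C_real k S f"
proof (induction k arbitrary: f)
  case 0
  then show ?case by (auto intro: DERIV_continuous_on DERIV_subset)
next
  case (Suc k)
  then show ?case by (metis C_real.simps(2))
qed

lemma C_real_const: "C_real k S (\<lambda>x. c)"
proof (induction k arbitrary: c)
  case (Suc k)
  then show ?case by (intro C_real_SucI[of S _ "\<lambda>x. 0"]) auto
qed simp

lemma C_real_ident: "C_real k S (\<lambda>x. x)"
proof (cases k)
  case (Suc j)
  then show ?thesis using C_real_SucI[of S "\<lambda>x. x" "\<lambda>x. 1"] C_real_const by simp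
qed simp

lemma C_real_add:
  assumes "C_real k S f" "C_real k S g"
  shows "C_real k S (\<lambda>x. f x + g x)"
  using assms
proof (induction k arbitrary: f g)
  case (Suc k)
  then obtain f' g' where *: "\<forall>x\<in>S. (f has_real_derivative f' x) (at x)" "C_real k S f'"
    "\<forall>x\<in>S. (g has_real_derivative g' x) (at x)" "C_real k S g'" by auto
  then have "\<forall>x\<in>S. ((\<lambda>x. f x + g x) has_real_derivative f' x + g' x) (at x)"
    by (auto intro: DERIV_add)
  from C_real_SucI[OF this Suc.IH[OF *(2,4)]] show ?case .
qed (auto intro: continuous_intros)

lemma C_real_mult:
  assumes "C_real k S f" "C_real k S g"
  shows "C_real k S (\<lambda>x. f x * g x)"
  using assms
proof (induction k arbitrary: f g)
  case (Suc k)
  then obtain f' g' where *: "\<forall>x\<in>S. (f has_real_derivative f' x) (at x)" "C_real k S f'"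
    "\<forall>x\<in>S. (g has_real_derivative g' x) (at x)" "C_real k S g'" by auto
  then have "\<forall>x\<in>S. ((\<lambda>x. f x * g x) has_real_derivative f' x * g x + g' x * f x) (at x)"
    by (auto intro: DERIV_mult)
  moreover have "C_real k S (\<lambda>x. f' x * g x + g' x * f x)"
    using * Suc.prems[THEN C_real_Suc_D] by (intro C_real_add Suc.IH)
  ultimately show ?case by (rule C_real_SucI)
qed (auto intro: continuous_intros)

lemma C_real_compose:
  assumes "C_real k T g" "C_real k S f" "f ` S \<subseteq> T"
  shows "C_real k S (\<lambda>x. g (f x))"
  using assms(1,2)
proof (induction k arbitrary: g)
  case 0
  then show ?case using assms(3) by (auto intro: continuous_on_compose2)
next
  case (Suc k)
  then obtain f' g' where *: "\<forall>x\<in>S. (f has_real_derivative f' x) (at x)" "C_real k S f'"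
    "\<forall>x\<in>T. (g has_real_derivative g' x) (at x)" "C_real k T g'" by auto
  then have "\<forall>x\<in>S. ((\<lambda>x. g (f x)) has_real_derivative g' (f x) * f' x) (at x)"
    using assms(3) DERIV_chain2 by blast
  moreover have "C_real k S (\<lambda>x. g' (f x) * f' x)"
    using C_real_mult[OF Suc.IH[OF *(4) C_real_Suc_D[OF Suc.prems(2)]] *(2)] .
  ultimately show ?case by (rule C_real_SucI)
qed

text \<open>Bootstrapping: a solution of \<open>f' = \<phi>(f)\<close> gains one derivative from each composition.\<close>

lemma smooth_real_ode:
  assumes "smooth_real T \<phi>" "\<And>x. x \<in> S \<Longrightarrow> (f has_real_derivative \<phi> (f x)) (at x)" "f ` S \<subseteq> T"
  shows "smooth_real S f"
proof -
  have "C_real k S f" for k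
  proof (induction k)
    case 0
    show ?case unfolding C_real.simps
      by (rule DERIV_continuous_on[OF DERIV_subset[OF assms(2)]]) auto
  next
    case (Suc k)
    have "C_real k S (\<lambda>x. \<phi> (f x))"
      using C_real_compose[OF _ Suc assms(3)] assms(1) by (simp add: smooth_real_def)
    then show ?case using C_real_SucI[of S f "\<lambda>x. \<phi> (f x)" k] assms(2) by simp
  qed
  then show ?thesis by (simp add: smooth_real_def)
qed

lemma smooth_real_const: "smooth_real S (\<lambda>x. c)"
  by (simp add: smooth_real_def C_real_const)

lemma smooth_real_ident: "smooth_real S (\<lambda>x. x)"
  by (simp add: smooth_real_def C_real_ident)

lemma smooth_real_add:
  "smooth_real S f \<Longrightarrow> smooth_real S g \<Longrightarrow> smooth_real S (\<lambda>x. f x + g x)"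
  by (simp add: smooth_real_def C_real_add)

lemma smooth_real_mult:
  "smooth_real S f \<Longrightarrow> smooth_real S g \<Longrightarrow> smooth_real S (\<lambda>x. f x * g x)"
  by (simp add: smooth_real_def C_real_mult)

lemma smooth_real_compose:
  "smooth_real T g \<Longrightarrow> smooth_real S f \<Longrightarrow> f ` S \<subseteq> T \<Longrightarrow> smooth_real S (\<lambda>x. g (f x))"
  unfolding smooth_real_def using C_real_compose by blast

lemma smooth_real_diff:
  assumes "smooth_real S f" "smooth_real S g"
  shows "smooth_real S (\<lambda>x. f x - g x)"
  using smooth_real_add[OF assms(1) smooth_real_mult[OF smooth_real_const assms(2), of "-1"]] by simp

text \<open>\<open>inverse\<close> solves \<open>y' = - y * y\<close>, whose right side is a
  polynomial, so bootstrapping yields all orders at once; composition then does the rest.\<close>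

lemma smooth_real_inverse:
  assumes "smooth_real S f" "\<And>x. x \<in> S \<Longrightarrow> f x > 0"
  shows "smooth_real S (\<lambda>x. inverse (f x))"
proof -
  have "smooth_real UNIV (\<lambda>y::real. (-1) * (y * y))"
    by (intro smooth_real_mult smooth_real_const smooth_real_ident)
  then have "smooth_real {0<..} (inverse :: real \<Rightarrow> real)"
  proof (rule smooth_real_ode)
    fix x :: real assume "x \<in> {0<..}"
    then show "(inverse has_real_derivative (-1) * (inverse x * inverse x)) (at x)"
      by (auto intro!: derivative_eq_intros)
  qed simp
  then show ?thesis using assms by (intro smooth_real_compose[of "{0<..}" inverse S f]) auto
qed

lemma smooth_real_divide:
  assumes "smooth_real S f" "smooth_real S g" "\<And>x. x \<in> S \<Longrightarrow> g x > 0"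
  shows "smooth_real S (\<lambda>x. f x / g x)"
  unfolding divide_inverse by (intro smooth_real_mult smooth_real_inverse assms)

text \<open>The same device as for \<open>inverse\<close>: \<open>sqrt\<close> solves
  \<open>y' = 1 / (2 * y)\<close> on the positive half-line.\<close>

lemma smooth_real_sqrt:
  assumes "smooth_real S f" "\<And>x. x \<in> S \<Longrightarrow> f x > 0"
  shows "smooth_real S (\<lambda>x. sqrt (f x))"
proof -
  have "smooth_real {0<..} (\<lambda>y::real. inverse y * (1/2))"
    by (intro smooth_real_mult smooth_real_const smooth_real_inverse smooth_real_ident) simp
  then have "smooth_real {0<..} sqrt"
  proof (rule smooth_real_ode)
    fix x :: real assume "x \<in> {0<..}"
    then show "(sqrt has_real_derivative inverse (sqrt x) * (1/2)) (at x)"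
      by (auto intro!: derivative_eq_intros)
  qed auto
  then show ?thesis using assms by (intro smooth_real_compose[of "{0<..}" sqrt S f]) auto
qed

lemma smooth_real_continuous_on: "smooth_real S f \<Longrightarrow> continuous_on S f"
  using C_real.simps(1) unfolding smooth_real_def by blast

lemma smooth_real_deriv:
  assumes "smooth_real S f" "open S"
  shows "x \<in> S \<Longrightarrow> (f has_real_derivative deriv f x) (at x)" and "smooth_real S (deriv f)"
proof -
  have *: "(f has_real_derivative deriv f x) (at x)" if "x \<in> S" for x
    using assms(1) that C_real.simps(2)[of 0 S f] DERIV_imp_deriv
    unfolding smooth_real_def by metis
  then show "x \<in> S \<Longrightarrow> (f has_real_derivative deriv f x) (at x)" .
  have "C_real k S (deriv f)" for k
  proof -
    obtain f' where f': "\<forall>x\<in>S. (f has_real_derivative f' x) (at x)" "C_real k S f'"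
      using assms(1) C_real.simps(2)[of k S f] unfolding smooth_real_def by metis
    then show ?thesis
      by (intro C_real_cong[OF assms(2) _ f'(2)]) (auto simp: DERIV_imp_deriv)
  qed
  then show "smooth_real S (deriv f)" by (simp add: smooth_real_def)
qed

lemma smooth_real_subset: "smooth_real S f \<Longrightarrow> T \<subseteq> S \<Longrightarrow> smooth_real T f"
  using smooth_real_compose[OF _ smooth_real_ident, of S f T] by auto

lemma has_derivative_ridge:
  fixes i :: "'n::finite"
  assumes "(h has_real_derivative h') (at (x $ i))"
  shows "((\<lambda>x::real ^ 'n. h (x $ i)) has_derivative (\<lambda>v. h' * v $ i)) (at x)"
  using has_derivative_compose[OF bounded_linear_imp_has_derivative[OF bounded_linear_vec_nth]
      assms[unfolded has_field_derivative_def]] .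

lemma smooth_on_ridge:
  fixes f :: "real \<Rightarrow> real" and i :: "'n::finite"
  assumes "smooth_real UNIV f"
  shows "smooth_on UNIV (\<lambda>x::real ^ 'n. f (x $ i))"
proof -
  \<comment> \<open>The factor \<open>c\<close> closes the induction: the partial derivative in
    direction \<open>b\<close> is \<open>c * b $ i\<close> times \<open>f' (x $ i)\<close>, again a
    multiple of a function of one coordinate.\<close>
  have "Ck_on k UNIV (\<lambda>x::real ^ 'n. c * f (x $ i))" if "C_real k UNIV f" for k c f
    using that
  proof (induction k arbitrary: c f)
    case 0
    then show ?case by (auto intro!: continuous_intros continuous_on_compose2[of UNIV f])
  next
    case (Suc k)
    then obtain f' where f': "\<And>x. (f has_real_derivative f' x) (at x)" "C_real k UNIV f'" by auto
    have d: "((\<lambda>x::real ^ 'n. c * f (x $ i)) has_derivative (\<lambda>h. (c * h $ i) * f' (x $ i))) (at x)" for x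
      by (auto intro!: derivative_eq_intros has_derivative_ridge[OF f'(1)])
    have "frechet_derivative (\<lambda>x::real ^ 'n. c * f (x $ i)) (at x) b = (c * b $ i) * f' (x $ i)" for x b
      using frechet_derivative_at[OF d[of x]] by (metis (no_types, lifting))
    moreover have "(\<lambda>x::real ^ 'n. c * f (x $ i)) differentiable_on UNIV"
      using d by (auto simp: differentiable_on_def differentiable_def)
    ultimately show ?case using Suc.IH[OF f'(2)] by simp
  qed
  from this[of _ f 1] assms show ?thesis by (simp add: smooth_on_def smooth_real_def)
qed

text \<open>The partial derivative along \<open>(1, 0)\<close> of a function of two variables
  restricts to the derivative of its section. This brings the energy and the capillarity at the
  fixed entropy into the one-variable calculus.\<close>

lemma smooth_real_section:
  fixes f :: "real \<Rightarrow> real \<Rightarrow> real"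
  assumes "smooth_on (S \<times> UNIV) (\<lambda>(n, s). f n s)" "open S"
  shows "smooth_real S (\<lambda>n. f n s)"
proof -
  have "C_real k S (\<lambda>n. g (n, s))" if "Ck_on k (S \<times> UNIV) g" for k and g :: "real \<times> real \<Rightarrow> real"
    using that
  proof (induction k arbitrary: g)
    case 0
    then show ?case by (auto intro!: continuous_intros continuous_on_compose2[of "S \<times> UNIV" g])
  next
    case (Suc k)
    define g1 where "g1 z = frechet_derivative g (at z) (1, 0)" for z
    have "(1::real, 0::real) \<in> Basis" by (simp add: Basis_prod_def)
    then have 1: "Ck_on k (S \<times> UNIV) g1" using Suc.prems by (auto simp: g1_def[abs_def])
    have "((\<lambda>n. g (n, s)) has_real_derivative g1 (n, s)) (at n)" if "n \<in> S" for n
    proof -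
      have "open (S \<times> (UNIV :: real set))" by (intro open_Times assms open_UNIV)
      then have "g differentiable (at (n, s))"
        using Suc.prems that by (auto simp: differentiable_on_eq_differentiable_at)
      then have D: "(g has_derivative frechet_derivative g (at (n, s))) (at (n, s))"
        by (simp flip: frechet_derivative_works)
      have "((\<lambda>n. (n, s)) has_derivative (\<lambda>h. (h, 0))) (at n)"
        by (auto intro!: derivative_eq_intros)
      then have "((\<lambda>n. g (n, s)) has_derivative (\<lambda>h. frechet_derivative g (at (n, s)) (h, 0))) (at n)"
        using has_derivative_compose D by blast
      moreover have "frechet_derivative g (at (n, s)) (h, 0) = g1 (n, s) * h" for h
        using linear_scale[OF has_derivative_linear[OF D], of h "(1, 0)"] by (simp add: g1_def)
      ultimately show ?thesis by (simp add: has_field_derivative_def)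
    qed
    then show ?case using C_real_SucI[OF _ Suc.IH[OF 1]] by blast
  qed
  from this[of _ "\<lambda>(n, s). f n s"] assms(1) show ?thesis
    by (simp add: smooth_on_def smooth_real_def)
qed

section \<open>Reduction of the Euler--Korteweg system to an ordinary differential equation\<close>

lemma UNIV_index4: "(UNIV :: 4 set) = {0, 1, 2, 3}"
proof -
  \<comment> \<open>\<open>exhaust_4\<close> enumerates 1, 2, 3, 4; modulo 4 the last of these is
    the time index 0.\<close>
  have "(4 :: 4) = 0" by simp
  then have "x \<in> {0, 1, 2, 3}" for x :: 4
    using exhaust_4[of x] by (simp only: insert_iff) metis
  then show ?thesis by blast
qed

lemma sum_index4: "(\<Sum>i\<in>(UNIV :: 4 set). f i) = f 0 + f 1 + f 2 + f 3"
  unfolding UNIV_index4 by (simp add: add.assoc)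

lemma pd_ridge:
  assumes "(h has_real_derivative h') (at (x $ 1))"
  shows "pd \<beta> (\<lambda>x. h (x $ 1)) x = (if \<beta> = 1 then h' else 0)"
  unfolding pd_def frechet_derivative_at[OF has_derivative_ridge[OF assms], symmetric]
  by (simp add: axis_def)

lemma grad_ridge:
  assumes "(h has_real_derivative h') (at (x $ 1))"
  shows "grad (\<lambda>x. h (x $ 1)) x = axis 1 h'"
  by (simp add: grad_def pd_ridge[OF assms] vec_eq_iff axis_def)

lemma raise_axis_1: "raise (axis 1 a) = axis 1 a"
  by (auto simp: raise_def vec_eq_iff axis_def mink_def sum_index4)

lemma rho_bar_axis_1: "rho_bar \<rho> \<kappa> \<nu> (axis 1 a) \<sigma> = \<rho> \<nu> \<sigma> + 1/2 * \<kappa> \<nu> \<sigma> * a\<^sup>2"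
  unfolding rho_bar_def raise_axis_1 by (simp add: sum_index4 axis_def power2_eq_square)

text \<open>The variational derivative differentiates in all four gradient components before a
  planar gradient is inserted. The gradient term is a diagonal quadratic form, so at a multiple of
  \<open>axis 1 1\<close> only its first spatial derivative survives.\<close>

lemma rho_bar_gradient_derivative:
  "frechet_derivative (\<lambda>v. rho_bar \<rho> \<kappa> \<nu> v \<sigma>) (at (axis 1 a)) (axis \<gamma> 1)
    = (if \<gamma> = 1 then \<kappa> \<nu> \<sigma> * a else 0)"
proof -
  have "((\<lambda>v. \<rho> \<nu> \<sigma> + 1/2 * \<kappa> \<nu> \<sigma> * (- (v $ 0)\<^sup>2 + (v $ 1)\<^sup>2 + (v $ 2)\<^sup>2 + (v $ 3)\<^sup>2)) has_derivative
      (\<lambda>h. \<kappa> \<nu> \<sigma> * (a * h $ 1))) (at (axis 1 a :: real ^ 4))"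
    by (auto intro!: derivative_eq_intros ext simp: axis_def
        intro: bounded_linear_imp_has_derivative[OF bounded_linear_vec_nth])
  moreover have "rho_bar \<rho> \<kappa> \<nu> v \<sigma>
      = \<rho> \<nu> \<sigma> + 1/2 * \<kappa> \<nu> \<sigma> * (- (v $ 0)\<^sup>2 + (v $ 1)\<^sup>2 + (v $ 2)\<^sup>2 + (v $ 3)\<^sup>2)" for v
    by (simp add: rho_bar_def raise_def sum_index4 mink_def power2_eq_square)
  ultimately show ?thesis
    by (simp add: frechet_derivative_at[symmetric] axis_def)
qed

text \<open>The first integrals of the travelling wave equations: with \<open>n U\<^sup>1 = m\<close>, the component
  \<open>T\<^sup>0\<^sup>1 = c m\<close> fixes \<open>\<delta>\<rho>/\<delta>n = c / U\<^sup>0\<close>, after which \<open>T\<^sup>1\<^sup>1 = d\<close> becomes the energy equation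
  \<open>\<kappa> n'\<^sup>2 / 2 = F(n)\<close>; the second-order equation \<open>N2\<close> is its derivative divided by \<open>n'\<close>.\<close>

lemma profile_solves_euler_korteweg:
  fixes \<rho> \<kappa> :: "real \<Rightarrow> real \<Rightarrow> real" and s m c d :: real and N N1 N2 :: "real \<Rightarrow> real"
  assumes r: "smooth_real {0<..} (\<lambda>n. \<rho> n s)" and k: "smooth_real {0<..} (\<lambda>n. \<kappa> n s)"
    and N: "smooth_real UNIV N" "\<And>t. N t > 0"
    and N1: "\<And>t. (N has_real_derivative N1 t) (at t)"
    and N2: "\<And>t. (N1 has_real_derivative N2 t) (at t)"
    and energy: "\<And>t. \<kappa> (N t) s * (N1 t)\<^sup>2 / 2 = \<rho> (N t) s - c * sqrt ((N t)\<^sup>2 + m\<^sup>2) + d"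
    and second: "\<And>t. \<kappa> (N t) s * N2 t + deriv (\<lambda>n. \<kappa> n s) (N t) * (N1 t)\<^sup>2 / 2
        = deriv (\<lambda>n. \<rho> n s) (N t) - c * N t / sqrt ((N t)\<^sup>2 + m\<^sup>2)"
  shows "euler_korteweg_solution \<rho> \<kappa> (\<lambda>x. N (x $ 1)) (\<lambda>x. s)
    (\<lambda>x. planar (sqrt ((N (x $ 1))\<^sup>2 + m\<^sup>2) / N (x $ 1)) (m / N (x $ 1)))"
proof -
  define g where "g t = sqrt ((N t)\<^sup>2 + m\<^sup>2)" for t
  have g_pos: "g t > 0" for t
    using N(2)[of t] by (simp add: g_def add_pos_nonneg)
  have g_sq: "(g t)\<^sup>2 = (N t)\<^sup>2 + m\<^sup>2" for t
    by (simp add: g_def)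
  have smooth_g: "smooth_real UNIV g"
    unfolding g_def[abs_def] power2_eq_square using N(2)
    by (intro smooth_real_sqrt smooth_real_add smooth_real_mult N smooth_real_const)
       (simp add: add_pos_nonneg)
  \<comment> \<open>Constant flux gives \<open>V1 = m / N\<close>, and the normalisation of the
    4-velocity then forces \<open>V0\<^sup>2 = 1 + V1\<^sup>2 = (g / N)\<^sup>2\<close>.\<close>
  define V0 where "V0 t = g t / N t" for t
  define V1 where "V1 t = m / N t" for t
  have smooth_V0: "smooth_real UNIV V0" and smooth_V1: "smooth_real UNIV V1"
    unfolding V0_def[abs_def] V1_def[abs_def]
    by (intro smooth_real_divide smooth_g N smooth_real_const)+
  let ?n = "\<lambda>x::real ^ 4. N (x $ 1)" and ?U = "\<lambda>x::real ^ 4. planar (V0 (x $ 1)) (V1 (x $ 1))"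
  define R where "R t = \<rho> (N t) s" for t
  define K where "K t = \<kappa> (N t) s" for t
  \<comment> \<open>This is \<open>n\<close> times the variational derivative minus the extended
    energy, with \<open>c * N / g\<close> for the former and \<open>2 * R - c * g + d\<close> for
    the latter; the energy equation has removed the derivatives of \<open>N\<close>.\<close>
  define P where "P t = c * (N t)\<^sup>2 / g t - 2 * R t + c * g t - d" for t
  have smooth_R: "smooth_real UNIV R" and smooth_K: "smooth_real UNIV K"
    unfolding R_def[abs_def] K_def[abs_def] using N
    by (intro smooth_real_compose[OF r] smooth_real_compose[OF k]; auto)+
  have smooth_P: "smooth_real UNIV P"
    unfolding P_def[abs_def] power2_eq_square
    by (intro smooth_real_add smooth_real_diff smooth_real_divide smooth_real_mult N smooth_g smooth_R
        smooth_real_const g_pos)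
  have deriv_rho_bar: "deriv (\<lambda>\<nu>. rho_bar \<rho> \<kappa> \<nu> (axis 1 a) s) (N t)
      = deriv (\<lambda>n. \<rho> n s) (N t) + 1/2 * deriv (\<lambda>n. \<kappa> n s) (N t) * a\<^sup>2" for a t
    unfolding rho_bar_axis_1 using N(2)[of t]
    by (intro DERIV_imp_deriv)
       (auto intro!: derivative_eq_intros intro: smooth_real_deriv(1)[OF r] smooth_real_deriv(1)[OF k])
  have grad_n: "grad ?n x = axis 1 (N1 (x $ 1))" for x
    using grad_ridge[OF N1] .
  have var_deriv: "var_deriv \<rho> \<kappa> ?n (\<lambda>x. s) x = c * N (x $ 1) / g (x $ 1)" for x
  proof -
    have "((\<lambda>t. K t * N1 t) has_real_derivative
        (deriv (\<lambda>n. \<kappa> n s) (N t) * N1 t) * N1 t + N2 t * K t) (at t)" for t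
      unfolding K_def using N(2)[of t]
      by (intro DERIV_mult N2 DERIV_chain2[OF smooth_real_deriv(1)[OF k]] N1) auto
    from pd_ridge[OF this]
    have "pd 1 (\<lambda>y. K (y $ 1) * N1 (y $ 1)) x
        = (deriv (\<lambda>n. \<kappa> n s) (N (x $ 1)) * N1 (x $ 1)) * N1 (x $ 1) + N2 (x $ 1) * K (x $ 1)"
      by simp
    moreover have "pd \<gamma> (\<lambda>y. 0) x = 0" for \<gamma>
      by (simp add: pd_def)
    ultimately show ?thesis
      using second[of "x $ 1"]
      by (simp add: var_deriv_def grad_n rho_bar_gradient_derivative deriv_rho_bar sum_index4
          power2_eq_square g_def K_def algebra_simps)
  qed
  have rho_bar: "rho_bar \<rho> \<kappa> (N t) (axis 1 (N1 t)) s = 2 * R t - c * g t + d" for t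
    using energy[of t] by (simp add: rho_bar_axis_1 R_def g_def)
  have p_bar: "p_bar \<rho> \<kappa> ?n (\<lambda>x. s) x = P (x $ 1)" for x
    unfolding p_bar_def var_deriv grad_n rho_bar by (simp add: P_def power2_eq_square)
  \<comment> \<open>Here \<open>\<kappa> n'\<^sup>2\<close> is replaced by
    \<open>2 * (R - c * g + d)\<close>. The tensor becomes an expression in \<open>N\<close> alone,
    so its smoothness and its constancy in \<open>t\<close> can be read off without derivatives of
    the profile.\<close>
  define T where "T \<alpha> \<beta> t = (2 * R t - c * g t + d) * (planar (V0 t) (V1 t) $ \<alpha> * planar (V0 t) (V1 t) $ \<beta>)
     + P t * (mink \<alpha> \<beta> + planar (V0 t) (V1 t) $ \<alpha> * planar (V0 t) (V1 t) $ \<beta>)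
     + (if \<alpha> = 1 \<and> \<beta> = 1 then 2 * (R t - c * g t + d) else 0)" for \<alpha> \<beta> t
  have T_bar: "T_bar \<rho> \<kappa> ?n (\<lambda>x. s) ?U \<alpha> \<beta> x = T \<alpha> \<beta> (x $ 1)" for \<alpha> \<beta> x
    using energy[of "x $ 1"] unfolding T_bar_def grad_n rho_bar p_bar raise_axis_1 T_def
    by (simp add: axis_def R_def g_def power2_eq_square)
  have smooth_planar: "smooth_real UNIV (\<lambda>t. planar (V0 t) (V1 t) $ \<alpha>)" for \<alpha>
    using smooth_V0 smooth_V1 by (cases "\<alpha> = 0"; cases "\<alpha> = 1") (simp_all add: planar_def smooth_real_const)
  have smooth_T: "smooth_real UNIV (T \<alpha> \<beta>)" for \<alpha> \<beta>
  proof -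
    have "smooth_real UNIV (\<lambda>t. if \<alpha> = 1 \<and> \<beta> = 1 then 2 * (R t - c * g t + d) else 0)"
    proof (cases "\<alpha> = 1 \<and> \<beta> = 1")
      case True
      show ?thesis unfolding if_P[OF True]
        by (intro smooth_real_add smooth_real_diff smooth_real_mult smooth_R smooth_g smooth_real_const)
    qed (simp only: if_False smooth_real_const)
    then show ?thesis unfolding T_def[abs_def]
      by (intro smooth_real_add smooth_real_diff smooth_real_mult smooth_R smooth_g smooth_real_const
          smooth_planar smooth_P)
  qed
  have T_01: "T 0 1 t = c * m" for t
    using N(2)[of t] g_pos[of t]
    by (simp add: T_def planar_def mink_def V0_def V1_def P_def field_simps power2_eq_square)
  \<comment> \<open>Extended energy and pressure add up to \<open>c * N\<^sup>2 / g\<close>. Since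
    \<open>1 + V1\<^sup>2 = g\<^sup>2 / N\<^sup>2\<close>, their contribution reduces to
    \<open>c * g\<close>, which the remaining terms cancel down to \<open>d\<close>.\<close>
  have T_11: "T 1 1 t = d" for t
  proof -
    have "1 + V1 t * V1 t = (g t)\<^sup>2 / (N t)\<^sup>2"
      using N(2)[of t] g_sq[of t] by (simp add: V1_def field_simps power2_eq_square)
    moreover have "T 1 1 t = (c * (N t)\<^sup>2 / g t) * (1 + V1 t * V1 t) - c * g t + d"
    proof -
      obtain A where A: "A = c * (N t)\<^sup>2 / g t" by blast
      have "T 1 1 t = (2 * R t - c * g t + d) * (V1 t * V1 t) + P t * (1 + V1 t * V1 t)
          + 2 * (R t - c * g t + d)"
        by (simp add: T_def planar_def mink_def)
      then show ?thesis unfolding P_def A[symmetric] by (simp add: ring_distribs)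
    qed
    ultimately show ?thesis
      using N(2)[of t] g_pos[of t] by (simp add: power2_eq_square)
  qed
  have "\<exists>C. \<forall>t. T \<alpha> 1 t = C" for \<alpha>
  proof -
    have "\<alpha> = 0 \<or> \<alpha> = 1 \<or> \<alpha> = 2 \<or> \<alpha> = 3" using UNIV_index4 by auto
    moreover have "T 2 1 t = 0" "T 3 1 t = 0" for t
      by (simp_all add: T_def planar_def mink_def)
    ultimately show ?thesis using T_01 T_11 by blast
  qed
  then have dT: "pd \<beta> (\<lambda>x. T \<alpha> \<beta> (x $ 1)) x = 0" for \<alpha> \<beta> x
  proof (cases "\<beta> = 1")
    case True
    with \<open>\<exists>C. \<forall>t. T \<alpha> 1 t = C\<close> show ?thesis by (auto simp: pd_def)
  next
    case False
    then show ?thesis using pd_ridge[OF smooth_real_deriv(1)[OF smooth_T]] by simp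
  qed
  have "pd \<beta> (\<lambda>y. N (y $ 1) * ?U y $ \<beta>) x = 0" for \<beta> x
  proof (cases "\<beta> = 1")
    case True
    have "N t * planar (V0 t) (V1 t) $ 1 = m" for t
      using N(2)[of t] by (simp add: planar_def V1_def)
    with True show ?thesis by (simp add: pd_def)
  next
    case False
    have "smooth_real UNIV (\<lambda>t. N t * planar (V0 t) (V1 t) $ \<beta>)"
      by (intro smooth_real_mult N smooth_planar)
    from pd_ridge[OF smooth_real_deriv(1)[OF this open_UNIV UNIV_I]] False show ?thesis by simp
  qed
  moreover have "mink_dot (?U x) (?U x) = -1" for x
    using N(2)[of "x $ 1"] g_sq[of "x $ 1"]
    by (simp add: mink_dot_def sum_index4 mink_def planar_def V0_def V1_def field_simps power2_eq_square)
  moreover have "?U x $ 0 > 0" for x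
    using N(2) g_pos by (simp add: planar_def V0_def)
  moreover have "smooth_on UNIV (\<lambda>x. ?U x $ \<alpha>)" for \<alpha>
    using smooth_on_ridge[OF smooth_planar] .
  ultimately show ?thesis
    unfolding euler_korteweg_solution_def V0_def[symmetric] V1_def[symmetric] g_def[symmetric] T_bar
    using smooth_on_ridge[where i = "1 :: 4", OF N(1)] smooth_on_ridge[where i = "1 :: 4", OF smooth_real_const[of UNIV s]] N(2)
    by (simp add: T_bar dT)
qed

section \<open>Heteroclinic orbits of scalar equations\<close>

text \<open>Comparison with the logarithm: \<open>X x - k * ln (x - a)\<close> is nondecreasing, so
  \<open>X\<close> must follow the logarithm down to minus infinity at \<open>a\<close>.\<close>

lemma antiderivative_unbounded_below:
  fixes X \<psi> :: "real \<Rightarrow> real"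
  assumes "a < b" "k > 0"
    and X: "\<And>x. a < x \<Longrightarrow> x < b \<Longrightarrow> (X has_real_derivative \<psi> x) (at x)"
    and \<psi>: "\<And>x. a < x \<Longrightarrow> x < b \<Longrightarrow> \<psi> x \<ge> k / (x - a)"
  shows "\<exists>x. a < x \<and> x < b \<and> X x < M"
proof -
  define c where "c = (a + b) / 2"
  have c: "a < c" "c < b" using assms(1) by (auto simp: c_def)
  \<comment> \<open>The first entry keeps \<open>x = a + exp L\<close> in the left half of the
    interval; the second pushes the upper bound for \<open>X x\<close> down to
    \<open>M - k\<close>.\<close>
  define L where "L = min (ln (c - a)) (ln (c - a) + (M - X c) / k - 1)"
  define x where "x = a + exp L"
  have "exp L \<le> c - a"
    using c by (subst ln_ge_iff[symmetric]) (auto simp: L_def)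
  then have x: "a < x" "x \<le> c" by (auto simp: x_def)
  have "X x - k * ln (x - a) \<le> X c - k * ln (c - a)"
  proof (rule DERIV_nonneg_imp_nondecreasing[OF x(2)])
    fix t assume t: "x \<le> t" "t \<le> c"
    with x c have "((\<lambda>t. X t - k * ln (t - a)) has_real_derivative \<psi> t - k * (1 / (t - a))) (at t)"
      by (auto intro!: derivative_eq_intros X)
    then show "\<exists>y. ((\<lambda>t. X t - k * ln (t - a)) has_real_derivative y) (at t) \<and> 0 \<le> y"
      using \<psi>[of t] t x c by (intro exI conjI) auto
  qed
  then have "X x \<le> X c - k * (ln (c - a) - L)"
    by (simp add: x_def algebra_simps)
  also have "\<dots> \<le> X c - k * (ln (c - a) - (ln (c - a) + (M - X c) / k - 1))"
    using assms(2) by (intro diff_left_mono mult_left_mono) (auto simp: L_def)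
  also have "\<dots> < M"
    using assms(2) by (simp add: field_simps)
  finally show ?thesis using x c by auto
qed

text \<open>Zeros of at least first order of the speed \<open>\<phi>\<close> at both ends are reached only at infinite time,
  so the solution is the global inverse of an antiderivative of \<open>1/\<phi>\<close>.\<close>

lemma heteroclinic_ode_solution:
  fixes \<phi> :: "real \<Rightarrow> real"
  assumes "a < b" and smooth: "smooth_real {a<..<b} \<phi>"
    and pos: "\<And>x. a < x \<Longrightarrow> x < b \<Longrightarrow> \<phi> x > 0"
    and C: "\<And>x. a < x \<Longrightarrow> x < b \<Longrightarrow> \<phi> x \<le> C * (x - a)"
           "\<And>x. a < x \<Longrightarrow> x < b \<Longrightarrow> \<phi> x \<le> C * (b - x)"
  obtains N where "smooth_real UNIV N" "\<And>t. a < N t \<and> N t < b"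
    "\<And>t. (N has_real_derivative \<phi> (N t)) (at t)"
    "(N \<longlongrightarrow> a) at_bot" "(N \<longlongrightarrow> b) at_top"
proof -
  have "C * ((a + b) / 2 - a) > 0"
    using C(1)[of "(a + b) / 2"] pos[of "(a + b) / 2"] assms(1) by auto
  then have "C > 0" using assms(1) by (simp add: zero_less_mult_iff)
  define \<psi> where "\<psi> x = inverse (\<phi> x)" for x
  have "isCont \<psi> x" if "a < x" "x < b" for x
    using smooth_real_continuous_on[OF smooth] that pos[OF that]
    by (auto simp: \<psi>_def[abs_def] continuous_on_eq_continuous_at intro!: continuous_intros)
  then obtain X where X: "\<And>x. a < x \<Longrightarrow> x < b \<Longrightarrow> (X has_real_derivative \<psi> x) (at x)"
    using einterval_antiderivative[of "ereal a" "ereal b" \<psi>] assms(1)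
    by (auto simp: has_real_derivative_iff_has_vector_derivative)
  have mono: "X x < X y" if "a < x" "x < y" "y < b" for x y
  proof (rule DERIV_pos_imp_increasing[OF that(2)])
    fix t assume "x \<le> t" "t \<le> y"
    with that show "\<exists>d. (X has_real_derivative d) (at t) \<and> 0 < d"
      by (intro exI[of _ "\<psi> t"] conjI X) (auto simp: \<psi>_def intro!: pos)
  qed
  have \<psi>_ge: "\<psi> x \<ge> (1 / C) / (x - a)" "\<psi> x \<ge> (1 / C) / (b - x)" if "a < x" "x < b" for x
    using C[OF that] pos[OF that] \<open>C > 0\<close> that
    by (auto simp: \<psi>_def inverse_eq_divide intro!: divide_left_mono)
  have onto: "\<exists>x. a < x \<and> x < b \<and> X x = t" for t
  proof -
    obtain x where x: "a < x" "x < b" "X x < t"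
      using antiderivative_unbounded_below[OF assms(1) _ X, of "1 / C" t] \<open>C > 0\<close> \<psi>_ge by auto
    \<comment> \<open>The behaviour at \<open>b\<close> is the behaviour at \<open>a\<close> of the
      reflected function \<open>- X (a + b - z)\<close>.\<close>
    have "\<exists>z. a < z \<and> z < b \<and> - X (a + b - z) < - t"
    proof (rule antiderivative_unbounded_below[OF assms(1)])
      show "1 / C > 0" using \<open>C > 0\<close> by simp
      fix z assume z: "a < z" "z < b"
      show "((\<lambda>z. - X (a + b - z)) has_real_derivative \<psi> (a + b - z)) (at z)"
      proof -
        have "(X has_real_derivative \<psi> (a + b - z)) (at (a + b - z))" using z by (intro X) auto
        moreover have "((\<lambda>z. a + b - z) has_real_derivative - 1) (at z)"
          by (auto intro!: derivative_eq_intros)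
        ultimately show ?thesis using DERIV_minus[OF DERIV_chain2] by fastforce
      qed
      show "1 / C / (z - a) \<le> \<psi> (a + b - z)"
        using \<psi>_ge(2)[of "a + b - z"] z by (simp add: algebra_simps)
    qed
    then obtain z where z: "a < z" "z < b" "X (a + b - z) > t" by auto
    define y where "y = a + b - z"
    have y: "a < y" "y < b" "X y > t" using z by (auto simp: y_def)
    have "x \<le> y"
      using mono[of y x] x y by fastforce
    moreover have "\<forall>u. x \<le> u \<and> u \<le> y \<longrightarrow> isCont X u"
      using x y by (auto intro!: DERIV_isCont[OF X])
    ultimately obtain u where "x \<le> u" "u \<le> y" "X u = t"
      using IVT[of X x t y] x y by auto
    with x y show ?thesis by (intro exI[of _ u]) auto
  qed
  then obtain N where N: "\<And>t. a < N t \<and> N t < b \<and> X (N t) = t" by metis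
  have inv: "N (X x) = x" if "a < x" "x < b" for x
    using N[of "X x"] mono[of x "N (X x)"] mono[of "N (X x)" x] that
    by (metis less_irrefl linorder_neqE_linordered_idom)
  have deriv: "(N has_real_derivative \<phi> (N t)) (at t)" for t
  proof -
    have "(N has_derivative (*) (\<phi> (N t))) (at (X (N t)))"
    proof (rule has_derivative_inverse_strong[of "{a<..<b}" _ X])
      show "continuous_on {a<..<b} X"
        using X by (intro continuous_at_imp_continuous_on) (auto intro!: DERIV_isCont)
      show "(X has_derivative (*) (\<psi> (N t))) (at (N t))"
        using X N[of t] by (simp add: has_field_derivative_def)
      show "(*) (\<psi> (N t)) \<circ> (*) (\<phi> (N t)) = id"
        using pos[of "N t"] N[of t] by (auto simp: \<psi>_def)
    qed (use N[of t] inv in auto)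
    then show ?thesis using N[of t] by (simp add: has_field_derivative_def)
  qed
  have "smooth_real UNIV N"
    by (rule smooth_real_ode[OF smooth deriv]) (use N in auto)
  moreover have "(N \<longlongrightarrow> a) at_bot"
  proof (rule order_tendstoI)
    fix u assume "a < u"
    then obtain x where x: "a < x" "x < min u b" using dense[of a "min u b"] assms(1) by auto
    have "N t < u" if "t \<le> X x" for t
      using N[of t] mono[of x "N t"] x that by fastforce
    then show "\<forall>\<^sub>F t in at_bot. N t < u" by (auto simp: eventually_at_bot_linorder)
  qed (use N less_trans in \<open>blast intro: always_eventually\<close>)
  moreover have "(N \<longlongrightarrow> b) at_top"
  proof (rule order_tendstoI)
    fix u assume "u < b"
    then obtain x where x: "max u a < x" "x < b" using dense[of "max u a" b] assms(1) by auto
    have "u < N t" if "X x \<le> t" for t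
      using N[of t] mono[of "N t" x] x that by fastforce
    then show "\<forall>\<^sub>F t in at_top. u < N t" by (auto simp: eventually_at_top_linorder)
  qed (use N less_trans in \<open>blast intro: always_eventually\<close>)
  ultimately show ?thesis using that N deriv by blast
qed

text \<open>Two applications of the mean value inequality, with \<open>C\<close> a bound for the
  second derivative. At a double zero this makes the square root of \<open>F\<close> at most linear
  in the distance, as infinite travel time requires; one \<open>C\<close> serves both ends.\<close>

lemma quadratic_bound:
  fixes F F' F'' :: "real \<Rightarrow> real"
  assumes "a \<le> b"
    and F: "\<And>x. x \<in> {a..b} \<Longrightarrow> (F has_real_derivative F' x) (at x)"
    and F': "\<And>x. x \<in> {a..b} \<Longrightarrow> (F' has_real_derivative F'' x) (at x)"
    and "continuous_on {a..b} F''"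
  obtains C where "C \<ge> 0"
    "\<And>z x. z \<in> {a..b} \<Longrightarrow> x \<in> {a..b} \<Longrightarrow> F z = 0 \<Longrightarrow> F' z = 0 \<Longrightarrow> F x \<le> C * (x - z)\<^sup>2"
proof -
  have "bounded (F'' ` {a..b})"
    using assms(4) by (intro compact_imp_bounded compact_continuous_image) auto
  then obtain C where C: "\<And>x. x \<in> {a..b} \<Longrightarrow> \<bar>F'' x\<bar> \<le> C"
    unfolding bounded_iff by (metis imageI real_norm_def)
  have "C \<ge> 0" using C[of a] assms(1) by auto
  moreover have "F x \<le> C * (x - z)\<^sup>2"
    if z: "z \<in> {a..b}" and x: "x \<in> {a..b}" and zero: "F z = 0" "F' z = 0" for z x
  proof -
    have F'_le: "\<bar>F' y\<bar> \<le> C * \<bar>y - z\<bar>" if y: "y \<in> {a..b}" for y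
      using field_differentiable_bound[of "{a..b}" F' F'' C y z,
          OF _ has_field_derivative_at_within[OF F']] C z y zero
      by simp
    have seg: "closed_segment z x \<subseteq> {a..b}"
      using z x by (auto simp: closed_segment_eq_real_ivl split: if_splits)
    have "norm (F x - F z) \<le> (C * \<bar>x - z\<bar>) * norm (x - z)"
    proof (rule field_differentiable_bound[of "closed_segment z x" F F'])
      fix y assume y: "y \<in> closed_segment z x"
      then have "\<bar>y - z\<bar> \<le> \<bar>x - z\<bar>" by (auto simp: closed_segment_eq_real_ivl split: if_splits)
      then show "norm (F' y) \<le> C * \<bar>x - z\<bar>"
        using F'_le[of y] y seg \<open>C \<ge> 0\<close> mult_left_mono[of "\<bar>y - z\<bar>" "\<bar>x - z\<bar>" C] by auto
      show "(F has_field_derivative F' y) (at y within closed_segment z x)"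
        using F[OF subsetD[OF seg y]] by (rule has_field_derivative_at_within)
    qed auto
    then show ?thesis using zero by (simp add: power2_eq_square abs_le_iff mult.assoc)
  qed
  ultimately show ?thesis using that by blast
qed

section \<open>Maxwell's construction\<close>

text \<open>The Maxwell construction at rest. Along a level \<open>P\<close> of the pressure \<open>p = n r' - r\<close>, the
  function \<open>(r + P) / n\<close> has derivative \<open>(p - P) / n\<^sup>2\<close> and equals \<open>r'\<close> wherever \<open>p = P\<close>; it
  compares the chemical potentials of two states of equal pressure.\<close>

lemma chemical_potential_compare:
  fixes r r' p :: "real \<Rightarrow> real"
  assumes "0 < a" "a < b"
    and r: "\<And>n. n > 0 \<Longrightarrow> (r has_real_derivative r' n) (at n)"
    and p: "\<And>n. n > 0 \<Longrightarrow> p n = n * r' n - r n"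
    and P: "p a = P" "p b = P"
  shows "(\<And>n. a < n \<Longrightarrow> n < b \<Longrightarrow> p n > P) \<Longrightarrow> r' a < r' b"
    and "(\<And>n. a < n \<Longrightarrow> n < b \<Longrightarrow> p n < P) \<Longrightarrow> r' b < r' a"
proof -
  define q where "q n = (r n + P) / n" for n
  have q': "(q has_real_derivative (p n - P) / n\<^sup>2) (at n)" if "n > 0" for n
    unfolding q_def[abs_def] using that p[OF that]
    by (auto intro!: derivative_eq_intros r simp: field_simps power2_eq_square)
  have cont: "continuous_on {a..b} q"
    using assms(1) by (intro continuous_at_imp_continuous_on) (auto intro!: DERIV_isCont[OF q'])
  have ends: "q a = r' a" "q b = r' b"
    using p[of a] p[of b] P assms(1,2) by (auto simp: q_def field_simps)
  show "r' a < r' b" if "\<And>n. a < n \<Longrightarrow> n < b \<Longrightarrow> p n > P"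
    unfolding ends[symmetric]
  proof (rule DERIV_pos_imp_increasing_open[OF assms(2) _ cont])
    fix n assume "a < n" "n < b"
    then show "\<exists>y. (q has_real_derivative y) (at n) \<and> 0 < y"
      using q'[of n] that[of n] assms(1) by (intro exI[of _ "(p n - P) / n\<^sup>2"]) auto
  qed
  show "r' b < r' a" if "\<And>n. a < n \<Longrightarrow> n < b \<Longrightarrow> p n < P"
    unfolding ends[symmetric]
  proof (rule DERIV_neg_imp_decreasing_open[OF assms(2) _ cont])
    fix n assume "a < n" "n < b"
    then show "\<exists>y. (q has_real_derivative y) (at n) \<and> y < 0"
      using q'[of n] that[of n] assms(1)
      by (intro exI[of _ "(p n - P) / n\<^sup>2"]) (auto simp: divide_neg_pos)
  qed
qed

text \<open>If \<open>p > P\<close> on all of \<open>(0, A)\<close>, then \<open>(r + P) / n\<close>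
  would be increasing there, hence bounded as \<open>n\<close> tends to 0; yet it exceeds
  \<open>P / n\<close>.\<close>

lemma low_density_pressure:
  fixes r r' p :: "real \<Rightarrow> real"
  assumes "A > 0" "P > 0"
    and r: "\<And>n. n > 0 \<Longrightarrow> (r has_real_derivative r' n) (at n)"
    and p: "\<And>n. n > 0 \<Longrightarrow> p n = n * r' n - r n"
    and r_pos: "\<And>n. n > 0 \<Longrightarrow> r n > 0"
  shows "\<exists>n. 0 < n \<and> n < A \<and> p n \<le> P"
proof (rule ccontr)
  assume "\<not> ?thesis"
  then have big: "p n > P" if "0 < n" "n < A" for n using that by force
  define q where "q n = (r n + P) / n" for n
  have q': "(q has_real_derivative (p n - P) / n\<^sup>2) (at n)" if "n > 0" for n
    unfolding q_def[abs_def] using that p[OF that]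
    by (auto intro!: derivative_eq_intros r simp: field_simps power2_eq_square)
  have "q (A / 2) > 0"
    using assms(1,2) r_pos[of "A / 2"] by (simp add: q_def divide_pos_pos add_pos_pos)
  \<comment> \<open>Small enough that \<open>n * q (A / 2) \<le> P\<close>, whereas
    \<open>n * q n = r n + P\<close> is larger than \<open>P\<close>.\<close>
  define n where "n = min (A / 2) (P / q (A / 2))"
  have n: "0 < n" "n \<le> A / 2" "n * q (A / 2) \<le> P"
    using \<open>q (A / 2) > 0\<close> assms(1,2) by (auto simp: n_def min_def field_simps)
  have "q n \<le> q (A / 2)"
  proof (rule DERIV_nonneg_imp_nondecreasing[OF n(2)])
    fix x assume "n \<le> x" "x \<le> A / 2"
    then show "\<exists>y. (q has_real_derivative y) (at x) \<and> 0 \<le> y"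
      using q'[of x] big[of x] n assms(1) by (intro exI[of _ "(p x - P) / x\<^sup>2"]) auto
  qed
  then have "n * q n \<le> P" using n mult_left_mono[of "q n" "q (A / 2)" n] by linarith
  moreover have "n * q n = r n + P" using n by (simp add: q_def)
  ultimately show False using r_pos[of n] n by simp
qed

text \<open>An intermediate value argument over isobars. The density \<open>t\<close> on the right
  branch labels the level \<open>p t\<close>, and \<open>\<sigma> t\<close> is the state of equal
  pressure on the left branch; equality of the chemical potentials \<open>r'\<close> is the
  remaining equation.\<close>

lemma maxwell_construction:
  fixes r r' r'' p :: "real \<Rightarrow> real"
  assumes r: "\<And>n. n > 0 \<Longrightarrow> (r has_real_derivative r' n) (at n)"
    and r': "\<And>n. n > 0 \<Longrightarrow> (r' has_real_derivative r'' n) (at n)"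
    and p: "\<And>n. n > 0 \<Longrightarrow> p n = n * r' n - r n"
    and r_pos: "\<And>n. n > 0 \<Longrightarrow> r n > 0" and p_pos: "\<And>n. n > 0 \<Longrightarrow> p n > 0"
    and AB: "0 < A" "A < B"
    and convex_left: "\<And>n. 0 < n \<Longrightarrow> n < A \<Longrightarrow> r'' n > 0"
    and concave: "\<And>n. A < n \<Longrightarrow> n < B \<Longrightarrow> r'' n < 0"
    and convex_right: "\<And>n. B < n \<Longrightarrow> r'' n > 0"
    and recovers: "\<And>n. A < n \<Longrightarrow> n < B \<Longrightarrow> n < M \<and> p n \<le> p M"
  obtains a b where "0 < a" "a < A" "B < b" "r' a = r' b" "p a = p b"
    "\<And>n. a < n \<Longrightarrow> n < b \<Longrightarrow> r n - r' a * n + p a > 0"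
proof -
  have p': "(p has_real_derivative n * r'' n) (at n)" if "n > 0" for n
  proof -
    have "((\<lambda>n. n * r' n - r n) has_real_derivative n * r'' n) (at n)"
      using that by (auto intro!: derivative_eq_intros r r')
    moreover have "eventually (\<lambda>x. p x = x * r' x - r x) (nhds n)"
      using eventually_nhds_in_open[of "{0<..}" n] that p by (auto elim!: eventually_mono)
    ultimately show ?thesis using DERIV_cong_ev[OF refl _ refl, of p "\<lambda>x. x * r' x - r x"] by simp
  qed
  have cont_p: "continuous_on S p" if "S \<subseteq> {0<..}" for S
    using that by (intro continuous_at_imp_continuous_on) (auto intro!: DERIV_isCont[OF p'])
  have cont_r': "continuous_on S r'" if "S \<subseteq> {0<..}" for S
    using that by (intro continuous_at_imp_continuous_on) (auto intro!: DERIV_isCont[OF r'])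
  \<comment> \<open>Because \<open>p' = n * r''\<close>, pressure and chemical potential rise and
    fall together; both are handled by the same monotonicity facts.\<close>
  have slope: "\<exists>d. (f has_real_derivative d) (at n) \<and> sgn d = sgn (r'' n)"
    if "n > 0" "f = p \<or> f = r'" for f n
    using that p'[of n] r'[of n] by (auto simp: sgn_mult)
  have cont: "continuous_on {x..y} f" if "0 < x" "f = p \<or> f = r'" for f x y
  proof -
    have "{x..y} \<subseteq> {0<..}" using that by auto
    with cont_p cont_r' that show ?thesis by blast
  qed
  have increasing: "f x < f y" if "0 < x" "x < y" "\<And>n. x < n \<Longrightarrow> n < y \<Longrightarrow> r'' n > 0"
      "f = p \<or> f = r'" for f x y
  proof (rule DERIV_pos_imp_increasing_open[OF that(2) _ cont[OF that(1,4)]])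
    fix n assume "x < n" "n < y"
    then show "\<exists>d. (f has_real_derivative d) (at n) \<and> 0 < d"
      using slope[of n f] that(1,4) that(3)[of n] by (auto simp: sgn_1_pos)
  qed
  have decreasing: "f y < f x" if "0 < x" "x < y" "\<And>n. x < n \<Longrightarrow> n < y \<Longrightarrow> r'' n < 0"
      "f = p \<or> f = r'" for f x y
  proof (rule DERIV_neg_imp_decreasing_open[OF that(2) _ cont[OF that(1,4)]])
    fix n assume "x < n" "n < y"
    then show "\<exists>d. (f has_real_derivative d) (at n) \<and> d < 0"
      using slope[of n f] that(1,4) that(3)[of n] by (auto simp: sgn_1_neg)
  qed
  have p_AB: "p B < p A"
    using decreasing[of A B p] AB concave by auto
  have MB: "M \<ge> B"
    using recovers AB dense_le_bounded[of A B M] by fastforce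
  \<comment> \<open>The recovery hypothesis is available on the open interval \<open>(A, B)\<close>,
    so the bound at \<open>A\<close> is a limit from the right.\<close>
  have pA_le: "p A \<le> p M"
  proof (rule tendsto_upperbound)
    have "isCont p A" using DERIV_isCont[OF p'] AB by auto
    then show "(p \<longlongrightarrow> p A) (at_right A)"
      by (simp add: isCont_def filterlim_at_split)
    show "\<forall>\<^sub>F n in at_right A. p n \<le> p M"
      using recovers AB by (auto simp: eventually_at_right_field)
  qed simp
  obtain M' where M': "B \<le> M'" "p M' = p A"
    using IVT'[of p B "p A" M] p_AB pA_le MB cont[of B p M] AB by auto
  have "B < M'" using M' p_AB by (cases "B = M'") auto
  obtain a0 where a0: "0 < a0" "a0 < A" "p a0 \<le> p B"
    using low_density_pressure[of A "p B" r r' p] AB p_pos r p r_pos by (metis less_trans)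
  have inc_left: "p x < p y" if "0 < x" "x < y" "y \<le> A" for x y
    using increasing[of x y p] that convex_left by auto
  have inc_right: "p x < p y" if "B \<le> x" "x < y" for x y
    using increasing[of x y p] that convex_right AB by auto
  define \<sigma> where "\<sigma> t = inv_into {a0..A} p (p t)" for t
  have inj: "inj_on p {a0..A}"
  proof (rule linorder_inj_onI)
    fix x y assume "x < y" "x \<in> {a0..A}" "y \<in> {a0..A}"
    then show "p x \<noteq> p y" using inc_left[of x y] a0 by simp
  qed auto
  have image: "p ` {a0..A} = {p a0..p A}"
  proof (intro equalityI subsetI)
    fix y assume "y \<in> p ` {a0..A}"
    then obtain x where "y = p x" "a0 \<le> x" "x \<le> A" by auto
    then show "y \<in> {p a0..p A}" using inc_left[of a0 x] inc_left[of x A] a0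
      by (cases "x = a0"; cases "x = A") auto
  next
    fix y assume "y \<in> {p a0..p A}"
    then show "y \<in> p ` {a0..A}"
      using IVT'[of p a0 y A] cont[of a0 p A] a0 by force
  qed
  have range: "p t \<in> {p a0..p A}" if "t \<in> {B..M'}" for t
    using inc_right[of B t] inc_right[of t M'] that M' a0 by (cases "t = B"; cases "t = M'") auto
  have \<sigma>: "\<sigma> t \<in> {a0..A}" "p (\<sigma> t) = p t" if "t \<in> {B..M'}" for t
    using range[OF that] image inv_into_into[of "p t" p "{a0..A}"] f_inv_into_f[of "p t" p "{a0..A}"]
    by (auto simp: \<sigma>_def)
  have "continuous_on (p ` {a0..A}) (inv_into {a0..A} p)"
    using inj a0 cont[of a0 p A] by (intro continuous_on_inv) (simp_all add: inv_into_f_f)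
  then have "continuous_on {B..M'} (\<lambda>t. inv_into {a0..A} p (p t))"
    by (rule continuous_on_compose2) (use cont[of B p M'] AB range image in auto)
  then have cont_\<sigma>: "continuous_on {B..M'} \<sigma>"
    by (simp add: \<sigma>_def[abs_def])
  \<comment> \<open>At \<open>t = B\<close> the pressure between the two states lies above their
    common level, at \<open>t = M'\<close> below it; \<open>chemical_potential_compare\<close> turns
    this into opposite signs of \<open>G\<close>.\<close>
  define G where "G t = r' t - r' (\<sigma> t)" for t
  have "G B > 0"
  proof -
    have s: "\<sigma> B < A" "p (\<sigma> B) = p B" "0 < \<sigma> B"
      using \<sigma>[of B] M' p_AB a0 by (auto simp: less_le)
    have "p n > p B" if "\<sigma> B < n" "n < B" for n
      using inc_left[of "\<sigma> B" n] decreasing[of n B p] s that concave AB by (cases "n \<le> A") auto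
    then show ?thesis
      using chemical_potential_compare(1)[of "\<sigma> B" B r r' p "p B"] s AB r p by (auto simp: G_def)
  qed
  moreover have "G M' < 0"
  proof -
    have "\<sigma> M' = A" using \<sigma>[of M'] M' inc_left[of "\<sigma> M'" A] a0 by (cases "\<sigma> M' < A") auto
    moreover have "p n < p A" if "A < n" "n < M'" for n
      using decreasing[of A n p] inc_right[of n M'] M' that concave AB by (cases "n \<le> B") auto
    ultimately show ?thesis
      using chemical_potential_compare(2)[of A M' r r' p "p A"] M' \<open>B < M'\<close> AB r p
      by (auto simp: G_def)
  qed
  moreover have "continuous_on {B..M'} G"
  proof -
    have "continuous_on {B..M'} (\<lambda>t. r' (\<sigma> t))"
      by (rule continuous_on_compose2[OF cont[of a0 r' A] cont_\<sigma>]) (use a0 \<sigma> in auto)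
    then show ?thesis
      unfolding G_def[abs_def] using cont[of B r' M'] AB by (intro continuous_on_diff) auto
  qed
  ultimately obtain b where b: "B \<le> b" "b \<le> M'" "G b = 0"
    using IVT2'[of G M' 0 B] M' by auto
  have "b \<noteq> B" "b \<noteq> M'" using \<open>G B > 0\<close> \<open>G M' < 0\<close> b by auto
  then have b': "B < b" "b < M'" using b by auto
  define a where "a = \<sigma> b"
  have a: "0 < a" "p a = p b" "a \<le> A" using \<sigma>[of b] b a0 by (auto simp: a_def)
  have eq: "r' a = r' b" using b by (simp add: G_def a_def)
  have "a \<noteq> A" using inc_right[of b M'] M' a b' by auto
  then have "a < A" using a by simp
  \<comment> \<open>The height of \<open>r\<close> above its double tangent. Its derivative
    \<open>r' - r' a\<close> has the monotonicity of \<open>r'\<close>, which settles each of the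
    three density ranges.\<close>
  define F where "F n = r n - r' a * n + p a" for n
  have F': "(F has_real_derivative r' n - r' a) (at n)" if "n > 0" for n
    unfolding F_def[abs_def] using that by (auto intro!: derivative_eq_intros r)
  have cont_F: "continuous_on S F" if "S \<subseteq> {0<..}" for S
    using that by (intro continuous_at_imp_continuous_on) (auto intro!: DERIV_isCont[OF F'])
  have ends: "F a = 0" "F b = 0"
    using p[of a] p[of b] a eq b' AB by (auto simp: F_def algebra_simps)
  have left: "F n > 0" if n: "a < n" "n \<le> A" for n
  proof -
    have "F a < F n"
    proof (rule DERIV_pos_imp_increasing_open[OF n(1)])
      fix x assume "a < x" "x < n"
      then show "\<exists>y. (F has_real_derivative y) (at x) \<and> 0 < y"
        using F'[of x] increasing[of a x r'] convex_left a n by (intro exI[of _ "r' x - r' a"] conjI) auto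
    qed (use a in \<open>auto intro!: cont_F\<close>)
    with ends show ?thesis by simp
  qed
  have right: "F n > 0" if n: "B \<le> n" "n < b" for n
  proof -
    have "F b < F n"
    proof (rule DERIV_neg_imp_decreasing_open[OF n(2)])
      fix x assume "n < x" "x < b"
      then show "\<exists>y. (F has_real_derivative y) (at x) \<and> y < 0"
        using F'[of x] increasing[of x b r'] convex_right AB n eq by (intro exI[of _ "r' x - r' a"] conjI) auto
    qed (use AB n in \<open>auto intro!: cont_F\<close>)
    with ends show ?thesis by simp
  qed
  \<comment> \<open>On \<open>(A, B)\<close> the derivative of \<open>F\<close> decreases, so
    \<open>F\<close> has no interior minimum there: according to the sign of its derivative at
    \<open>n\<close>, it is bounded below by \<open>F A\<close> or by \<open>F B\<close>.\<close>
  have middle: "F n > 0" if n: "A < n" "n < B" for n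
  proof (cases "r' n \<ge> r' a")
    case True
    have "F A \<le> F n"
    proof (rule DERIV_nonneg_imp_nondecreasing[of A n F])
      fix x assume "A \<le> x" "x \<le> n"
      then show "\<exists>y. (F has_real_derivative y) (at x) \<and> 0 \<le> y"
        using F'[of x] decreasing[of x n r'] concave AB n True
        by (intro exI[of _ "r' x - r' a"] conjI; cases "x = n") auto
    qed (use n in auto)
    with left[of A] \<open>a < A\<close> show ?thesis by simp
  next
    case False
    have "F B \<le> F n"
    proof (rule DERIV_nonpos_imp_nonincreasing[of n B F])
      fix x assume "n \<le> x" "x \<le> B"
      then show "\<exists>y. (F has_real_derivative y) (at x) \<and> y \<le> 0"
        using F'[of x] decreasing[of n x r'] concave AB n False
        by (intro exI[of _ "r' x - r' a"] conjI; cases "x = n") auto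
    qed (use n in auto)
    with right[of B] b' show ?thesis by simp
  qed
  have "F n > 0" if "a < n" "n < b" for n
    using left[of n] right[of n] middle[of n] that by linarith
  then show ?thesis
    using that[of a b] a \<open>a < A\<close> b' eq by (simp add: F_def)
qed

section \<open>Perturbation to non-zero flux\<close>

text \<open>At flux \<open>m\<close>, the states \<open>a, b\<close> are connected if \<open>r - c g + d\<close> with
  \<open>g n = sqrt (n\<^sup>2 + m\<^sup>2)\<close> vanishes doubly at both. In terms of the potential \<open>\<mu> = r' / g'\<close> and
  the momentum flux \<open>\<pi> = \<mu> g - r\<close> this means \<open>\<mu> a = \<mu> b\<close> and \<open>\<pi> a = \<pi> b\<close>, and then
  \<open>c = \<mu> a\<close>, \<open>d = \<pi> a\<close>.\<close>

definition flux_root :: "real \<Rightarrow> real \<Rightarrow> real" where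
  "flux_root m n = sqrt (n\<^sup>2 + m\<^sup>2)"

definition flux_potential :: "(real \<Rightarrow> real) \<Rightarrow> real \<Rightarrow> real \<Rightarrow> real" where
  "flux_potential r' m n = r' n * flux_root m n / n"

definition flux_momentum :: "(real \<Rightarrow> real) \<Rightarrow> (real \<Rightarrow> real) \<Rightarrow> real \<Rightarrow> real \<Rightarrow> real" where
  "flux_momentum r r' m n = flux_potential r' m n * flux_root m n - r n"

lemma flux_root_pos: "n > 0 \<Longrightarrow> flux_root m n > 0"
  by (simp add: flux_root_def add_pos_nonneg)

lemma flux_root_less: "0 < x \<Longrightarrow> x < y \<Longrightarrow> flux_root m x < flux_root m y"
  by (simp add: flux_root_def power_strict_mono)

lemma DERIV_flux_root:
  assumes "n > 0"
  shows "(flux_root m has_real_derivative n / flux_root m n) (at n)"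
proof -
  have "n\<^sup>2 + m\<^sup>2 > 0" using assms by (simp add: add_pos_nonneg)
  then have "((\<lambda>n. sqrt (n\<^sup>2 + m\<^sup>2)) has_real_derivative
      inverse (sqrt (n\<^sup>2 + m\<^sup>2)) / 2 * (2 * n)) (at n)"
    by (intro DERIV_chain2[OF DERIV_real_sqrt]) (auto intro!: derivative_eq_intros)
  moreover have "inverse s / 2 * (2 * n) = n / s" for s :: real
    by (cases "s = 0") (simp_all add: field_simps)
  ultimately show ?thesis by (simp only: flux_root_def[abs_def])
qed

lemma DERIV_flux_potential:
  assumes "n > 0" "(r' has_real_derivative r'') (at n)"
  shows "(flux_potential r' m has_real_derivative
    r'' * flux_root m n / n - r' n * m\<^sup>2 / (flux_root m n * n\<^sup>2)) (at n)"
proof -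
  have g: "flux_root m n > 0" "m\<^sup>2 = (flux_root m n)\<^sup>2 - n\<^sup>2"
    using flux_root_pos[OF assms(1)] by (auto simp: flux_root_def)
  show ?thesis
    unfolding flux_potential_def[abs_def] using assms(1) g(1)
    by (auto intro!: derivative_eq_intros DERIV_flux_root assms simp: g(2))
       (simp add: field_simps power2_eq_square power3_eq_cube)
qed

lemma flux_zero:
  assumes "n > 0"
  shows "flux_root 0 n = n" "flux_potential r' 0 n = r' n" "flux_momentum r r' 0 n = n * r' n - r n"
  using assms by (simp_all add: flux_root_def flux_potential_def flux_momentum_def)

text \<open>By Cauchy's mean value theorem the quotient of the increments of \<open>r\<close> and
  \<open>g\<close> is \<open>r' / g' = \<mu>\<close> at an intermediate point. This is the finite
  form of \<open>d\<pi> = g d\<mu>\<close>: it says that \<open>\<pi> v - \<pi> u\<close> lies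
  strictly between \<open>g u\<close> and \<open>g v\<close> times
  \<open>\<mu> v - \<mu> u\<close>.\<close>

lemma chord_slope:
  assumes "0 < u" "u < v"
    and r: "\<And>n. n > 0 \<Longrightarrow> (r has_real_derivative r' n) (at n)"
    and mono: "\<And>x y. u \<le> x \<Longrightarrow> x < y \<Longrightarrow> y \<le> v \<Longrightarrow> flux_potential r' m x < flux_potential r' m y"
  shows "flux_potential r' m u * (flux_root m v - flux_root m u) < r v - r u"
    and "r v - r u < flux_potential r' m v * (flux_root m v - flux_root m u)"
proof -
  obtain x where x: "u < x" "x < v"
    and eq: "(r v - r u) * (x / flux_root m x) = (flux_root m v - flux_root m u) * r' x"
    using GMVT'[OF assms(2), of r "flux_root m" "\<lambda>x. x / flux_root m x" r'] assms(1)
      DERIV_isCont[OF r] DERIV_isCont[OF DERIV_flux_root[of _ m]] r DERIV_flux_root[of _ m]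
    by (auto 0 3)
  have pos: "x > 0" "flux_root m x > 0" "flux_root m v - flux_root m u > 0"
    using x assms(1,2) flux_root_pos[of x m] flux_root_less[OF assms(1,2), of m] by auto
  have "r v - r u = flux_potential r' m x * (flux_root m v - flux_root m u)"
    using eq pos by (simp add: flux_potential_def field_simps)
  then show "flux_potential r' m u * (flux_root m v - flux_root m u) < r v - r u"
    and "r v - r u < flux_potential r' m v * (flux_root m v - flux_root m u)"
    using mono[of u x] mono[of x v] x pos by auto
qed

text \<open>The equations \<open>\<mu> x = \<mu> y\<close>, \<open>\<pi> x = \<pi> y\<close> are solved near a given solution by invariance of
  domain; injectivity holds because \<open>d\<pi> = g d\<mu>\<close> and \<open>g\<close> is larger near \<open>b\<close> than near \<open>a\<close>.\<close>

lemma maxwell_perturbation: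
  fixes r r' r'' :: "real \<Rightarrow> real"
  assumes r: "\<And>n. n > 0 \<Longrightarrow> (r has_real_derivative r' n) (at n)"
    and r': "\<And>n. n > 0 \<Longrightarrow> (r' has_real_derivative r'' n) (at n)"
    and cont_r'': "continuous_on {0<..} r''"
    and ab: "0 < a" "a < b" "r'' a > 0" "r'' b > 0"
    and eq: "r' a = r' b" "a * r' a - r a = b * r' b - r b"
    and pos: "\<And>n. a < n \<Longrightarrow> n < b \<Longrightarrow> r n - r' a * n + (a * r' a - r a) > 0"
  obtains m_bar \<alpha> \<beta> where "m_bar > 0" "continuous_on {0..<m_bar} \<alpha>" "continuous_on {0..<m_bar} \<beta>"
    "\<And>m. m \<in> {0..<m_bar} \<Longrightarrow> 0 < \<alpha> m \<and> \<alpha> m < \<beta> m"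
    "\<And>m. m \<in> {0..<m_bar} \<Longrightarrow> flux_potential r' m (\<alpha> m) = flux_potential r' m (\<beta> m)"
    "\<And>m. m \<in> {0..<m_bar} \<Longrightarrow> flux_momentum r r' m (\<alpha> m) = flux_momentum r r' m (\<beta> m)"
    "\<And>m n. m \<in> {0..<m_bar} \<Longrightarrow> \<alpha> m < n \<Longrightarrow> n < \<beta> m \<Longrightarrow>
       r n - flux_potential r' m (\<alpha> m) * flux_root m n + flux_momentum r r' m (\<alpha> m) > 0"
proof -
  let ?\<mu> = "flux_potential r'" and ?\<pi> = "flux_momentum r r'" and ?g = flux_root
  \<comment> \<open>The density derivative of \<mu>. It is jointly continuous and equals
    \<open>r''\<close> at \<open>m = 0\<close>, hence positive near \<open>(0, a)\<close> and
    \<open>(0, b)\<close>.\<close>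
  define D where "D = (\<lambda>(m, n). r'' n * ?g m n / n - r' n * m\<^sup>2 / (?g m n * n\<^sup>2))"
  have D: "(?\<mu> m has_real_derivative D (m, n)) (at n)" if "n > 0" for m n
    using DERIV_flux_potential[OF that r'[OF that]] by (simp add: D_def)
  have cont_r: "continuous_on {0<..} r"
    by (intro continuous_at_imp_continuous_on) (auto intro!: DERIV_isCont[OF r])
  have cont_r': "continuous_on {0<..} r'"
    by (intro continuous_at_imp_continuous_on) (auto intro!: DERIV_isCont[OF r'])
  have cont_g: "continuous_on A (\<lambda>x. ?g (f x) (h x))"
    if "continuous_on A f" "continuous_on A h" for A and f h :: "'c::topological_space \<Rightarrow> real"
    unfolding flux_root_def by (intro continuous_intros that)
  have cont_\<mu>: "continuous_on A (\<lambda>x. ?\<mu> (f x) (h x))"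
    if "continuous_on A f" "continuous_on A h" "\<And>x. x \<in> A \<Longrightarrow> h x > 0"
    for A and f h :: "'c::topological_space \<Rightarrow> real"
    unfolding flux_potential_def using that(3)
    by (intro continuous_intros cont_g that(1,2) continuous_on_compose2[OF cont_r']) force+
  have cont_\<pi>: "continuous_on A (\<lambda>x. ?\<pi> (f x) (h x))"
    if "continuous_on A f" "continuous_on A h" "\<And>x. x \<in> A \<Longrightarrow> h x > 0"
    for A and f h :: "'c::topological_space \<Rightarrow> real"
    unfolding flux_momentum_def using that(3)
    by (intro continuous_intros cont_g cont_\<mu> that continuous_on_compose2[OF cont_r]) auto
  have "continuous_on (UNIV \<times> {0<..}) D"
    unfolding D_def split_beta
    by (intro continuous_intros cont_g continuous_on_compose2[OF cont_r''] continuous_on_compose2[OF cont_r'])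
       (use flux_root_pos in \<open>force simp: less_imp_neq[symmetric]\<close>)+
  then have open_pos: "open ((UNIV \<times> {0<..}) \<inter> D -` {0<..})"
    by (intro continuous_open_preimage open_Times) auto
  have near: "\<exists>\<delta>>0. \<forall>m n. \<bar>m\<bar> < \<delta> \<and> \<bar>n - x\<bar> < \<delta> \<longrightarrow> n > 0 \<and> D (m, n) > 0"
    if "x > 0" "r'' x > 0" for x
  proof -
    have "(0, x) \<in> (UNIV \<times> {0<..}) \<inter> D -` {0<..}"
      using that by (simp add: D_def flux_root_def)
    then obtain e where e: "e > 0" "ball (0, x) e \<subseteq> (UNIV \<times> {0<..}) \<inter> D -` {0<..}"
      using open_pos openE by blast
    have "n > 0 \<and> D (m, n) > 0" if "\<bar>m\<bar> < e / 2" "\<bar>n - x\<bar> < e / 2" for m n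
    proof -
      have "dist (0, x) (m, n) = norm ((m, n - x))"
        by (simp add: dist_norm norm_Pair power2_commute)
      also have "\<dots> \<le> norm m + norm (n - x)" by (rule norm_Pair_le)
      also have "\<dots> < e" using that by simp
      finally show ?thesis using e(2) by auto
    qed
    with e(1) show ?thesis by (intro exI[of _ "e / 2"]) auto
  qed
  obtain \<delta>1 where \<delta>1: "\<delta>1 > 0" "\<And>m n. \<bar>m\<bar> < \<delta>1 \<Longrightarrow> \<bar>n - a\<bar> < \<delta>1 \<Longrightarrow> n > 0 \<and> D (m, n) > 0"
    using near[OF ab(1,3)] by blast
  obtain \<delta>2 where \<delta>2: "\<delta>2 > 0" "\<And>m n. \<bar>m\<bar> < \<delta>2 \<Longrightarrow> \<bar>n - b\<bar> < \<delta>2 \<Longrightarrow> n > 0 \<and> D (m, n) > 0"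
    using near[of b] ab by auto
  \<comment> \<open>The entry \<open>(b - a) / 2\<close> keeps the neighbourhoods \<open>I\<close>
    of \<open>a\<close> and \<open>J\<close> of \<open>b\<close> apart, with \<open>I\<close> to the
    left.\<close>
  define \<delta> where "\<delta> = min (min \<delta>1 \<delta>2) ((b - a) / 2)"
  have \<delta>: "\<delta> > 0" "\<delta> \<le> \<delta>1" "\<delta> \<le> \<delta>2" "a + \<delta> \<le> b - \<delta>"
    using \<delta>1(1) \<delta>2(1) ab by (auto simp: \<delta>_def min_def field_simps)
  define I where "I = {a - \<delta><..<a + \<delta>}"
  define J where "J = {b - \<delta><..<b + \<delta>}"
  have I: "n > 0" "D (m, n) > 0" if "\<bar>m\<bar> < \<delta>" "n \<in> I" for m n
    using \<delta>1(2)[of m n] that \<delta> by (auto simp: I_def abs_if split: if_splits)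
  have J: "n > 0" "D (m, n) > 0" if "\<bar>m\<bar> < \<delta>" "n \<in> J" for m n
    using \<delta>2(2)[of m n] that \<delta> by (auto simp: J_def abs_if split: if_splits)
  have I_J: "x < y" if "x \<in> I" "y \<in> J" for x y
    using that \<delta>(4) by (auto simp: I_def J_def)
  have segment: "{x..y} \<subseteq> L" if "x \<in> L" "y \<in> L" "L = I \<or> L = J" for x y L
    using that by (auto simp: I_def J_def)
  have mono: "?\<mu> m x < ?\<mu> m y"
    if "\<bar>m\<bar> < \<delta>" "x \<in> L" "y \<in> L" "x < y" "L = I \<or> L = J" for m x y L
  proof (rule DERIV_pos_imp_increasing[OF that(4)])
    fix t assume "x \<le> t" "t \<le> y"
    then have "t \<in> L" using segment[OF that(2,3,5)] by auto
    then show "\<exists>d. (?\<mu> m has_real_derivative d) (at t) \<and> 0 < d"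
      using D I[OF that(1)] J[OF that(1)] that(5) by blast
  qed
  have chord: "?\<mu> m u * (?g m v - ?g m u) < r v - r u" "r v - r u < ?\<mu> m v * (?g m v - ?g m u)"
    if "\<bar>m\<bar> < \<delta>" "u \<in> L" "v \<in> L" "u < v" "L = I \<or> L = J" for m u v L
  proof -
    have "u > 0" using I[OF that(1)] J[OF that(1)] that(2,5) by blast
    moreover have "?\<mu> m x < ?\<mu> m y" if "u \<le> x" "x < y" "y \<le> v" for x y
      using mono[of m x L y] segment[of u L v] \<open>\<bar>m\<bar> < \<delta>\<close> \<open>u \<in> L\<close> \<open>v \<in> L\<close> \<open>L = I \<or> L = J\<close> that
      by (simp add: subset_iff)
    ultimately show "?\<mu> m u * (?g m v - ?g m u) < r v - r u" "r v - r u < ?\<mu> m v * (?g m v - ?g m u)"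
      using chord_slope[of u v r r' m] that(4) r by auto
  qed
  \<comment> \<open>Carrying \<open>m\<close> along as a third component makes domain and target
    three-dimensional, as invariance of domain demands, and makes the inverse continuous in
    \<open>m\<close>.\<close>
  define \<Phi> where "\<Phi> = (\<lambda>(x, y, m). (?\<mu> m x - ?\<mu> m y, ?\<pi> m x - ?\<pi> m y, m))"
  define S where "S = I \<times> J \<times> {-\<delta><..<\<delta>}"
  have S_iff: "(x, y, m) \<in> S \<longleftrightarrow> x \<in> I \<and> y \<in> J \<and> \<bar>m\<bar> < \<delta>" for x y m
    by (auto simp: S_def)
  have "open S" by (auto simp: S_def I_def J_def intro!: open_Times)
  have "continuous_on S \<Phi>"
    unfolding \<Phi>_def split_beta
    by (intro continuous_intros cont_\<mu> cont_\<pi>) (use I J in \<open>auto simp: S_iff\<close>)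
  \<comment> \<open>A shift from \<open>x\<close> up to \<open>x'\<close> forces an upward shift
    from \<open>y\<close> to \<open>y'\<close> with the same increment of \<mu>. The increment of
    \<pi> is then below \<open>g x'\<close> times this amount on the left and above
    \<open>g y\<close> times it on the right, although \<open>g x' < g y\<close>.\<close>
  have no_shift: False
    if "\<bar>m\<bar> < \<delta>" "x \<in> I" "x' \<in> I" "y \<in> J" "y' \<in> J" "x < x'"
      "?\<mu> m x - ?\<mu> m y = ?\<mu> m x' - ?\<mu> m y'" "?\<pi> m x - ?\<pi> m y = ?\<pi> m x' - ?\<pi> m y'" for x x' y y' m
  proof -
    have up: "?\<mu> m x < ?\<mu> m x'" using mono[of m x I x'] that by simp
    then have "?\<mu> m y < ?\<mu> m y'" using that by linarith
    then have "y < y'"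
      using mono[of m y' J y] that by (metis less_asym linorder_neqE_linordered_idom order_less_irrefl)
    have "?\<pi> m x' - ?\<pi> m x < ?g m x' * (?\<mu> m x' - ?\<mu> m x)"
      using chord(1)[of m x I x'] that by (simp add: flux_momentum_def algebra_simps)
    also have "\<dots> < ?g m y * (?\<mu> m x' - ?\<mu> m x)"
      using up flux_root_less[OF I(1) I_J] that by simp
    also have "?\<mu> m x' - ?\<mu> m x = ?\<mu> m y' - ?\<mu> m y"
      using that by linarith
    also have "?g m y * (?\<mu> m y' - ?\<mu> m y) < ?\<pi> m y' - ?\<pi> m y"
      using chord(2)[of m y J y'] that \<open>y < y'\<close> by (simp add: flux_momentum_def algebra_simps)
    finally show False using that by simp
  qed
  have "inj_on \<Phi> S"
  proof (rule inj_onI)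
    fix z z' assume z: "z \<in> S" "z' \<in> S" "\<Phi> z = \<Phi> z'"
    obtain x y m x' y' m' where split: "z = (x, y, m)" "z' = (x', y', m')"
      by (metis prod_cases3)
    have in_S: "x \<in> I" "y \<in> J" "x' \<in> I" "y' \<in> J" "\<bar>m\<bar> < \<delta>" using z split by (auto simp: S_iff)
    have e: "m' = m" "?\<mu> m x - ?\<mu> m y = ?\<mu> m x' - ?\<mu> m y'" "?\<pi> m x - ?\<pi> m y = ?\<pi> m x' - ?\<pi> m y'"
      using z(3) by (auto simp: \<Phi>_def split)
    have "x = x'"
      using no_shift[of m x x' y y'] no_shift[of m x' x y' y] in_S e by (metis linorder_neqE_linordered_idom)
    moreover from this have "y = y'"
      using mono[of m y J y'] mono[of m y' J y] in_S e by (metis diff_left_imp_eq linorder_neqE_linordered_idom order_less_irrefl)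
    ultimately show "z = z'" using split e by simp
  qed
  obtain G where G: "homeomorphism S (\<Phi> ` S) \<Phi> G"
    using invariance_of_domain_homeomorphism[OF \<open>open S\<close> \<open>continuous_on S \<Phi>\<close> _ \<open>inj_on \<Phi> S\<close>] by auto
  have "open (\<Phi> ` S)"
    using invariance_of_domain[OF \<open>continuous_on S \<Phi>\<close> \<open>open S\<close> \<open>inj_on \<Phi> S\<close>] .
  have ab_S: "(a, b, 0) \<in> S" using \<delta> by (simp add: S_iff I_def J_def)
  have "b > 0" using ab by simp
  then have \<Phi>_ab: "\<Phi> (a, b, 0) = (0, 0, 0)"
    using eq ab by (simp add: \<Phi>_def flux_zero)
  then have "(0, 0, 0) \<in> \<Phi> ` S" using ab_S by force
  then obtain e where e: "e > 0" "ball (0, 0, 0) e \<subseteq> \<Phi> ` S"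
    using \<open>open (\<Phi> ` S)\<close> openE by blast
  have line: "(0, 0, m) \<in> \<Phi> ` S" if "\<bar>m\<bar> < e" for m
    using e(2) that by (auto simp: dist_norm norm_Pair subset_iff)
  define \<alpha> where "\<alpha> m = fst (G (0, 0, m))" for m
  define \<beta> where "\<beta> m = fst (snd (G (0, 0, m)))" for m
  have sol: "\<bar>m\<bar> < \<delta>" "\<alpha> m \<in> I" "\<beta> m \<in> J" "?\<mu> m (\<alpha> m) = ?\<mu> m (\<beta> m)" "?\<pi> m (\<alpha> m) = ?\<pi> m (\<beta> m)"
    if "\<bar>m\<bar> < e" for m
  proof -
    obtain x y m' where xy: "G (0, 0, m) = (x, y, m')" by (metis prod_cases3)
    have "(x, y, m') \<in> S" "\<Phi> (x, y, m') = (0, 0, m)"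
      using homeomorphism_image2[OF G] homeomorphism_apply2[OF G line[OF that]] line[OF that] xy
      by (metis imageI)+
    then show "\<bar>m\<bar> < \<delta>" "\<alpha> m \<in> I" "\<beta> m \<in> J" "?\<mu> m (\<alpha> m) = ?\<mu> m (\<beta> m)" "?\<pi> m (\<alpha> m) = ?\<pi> m (\<beta> m)"
      by (auto simp: \<alpha>_def \<beta>_def xy S_iff \<Phi>_def)
  qed
  have "continuous_on {-e<..<e} (\<lambda>m. G (0, 0, m))"
    by (intro continuous_on_compose2[OF homeomorphism_cont2[OF G]] continuous_intros) (use line in auto)
  then have cont: "continuous_on {-e<..<e} \<alpha>" "continuous_on {-e<..<e} \<beta>"
    unfolding \<alpha>_def \<beta>_def by (auto intro!: continuous_intros)
  have "\<alpha> 0 = a"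
    using homeomorphism_apply1[OF G ab_S] by (simp add: \<Phi>_ab \<alpha>_def)
  define F where "F m n = r n - ?\<mu> m (\<alpha> m) * ?g m n + ?\<pi> m (\<alpha> m)" for m n
  \<comment> \<open>The middle densities, away from both tangency points. The range of
    \<open>m\<close> is closed at \<open>e / 2\<close> to make \<open>K\<close> compact inside the
    domain where \<alpha> is continuous.\<close>
  define K where "K = {0..e / 2} \<times> {a + \<delta>..b - \<delta>}"
  have cont_F: "continuous_on K (\<lambda>z. F (fst z) (snd z))"
  proof -
    have *: "continuous_on K (\<lambda>z. \<alpha> (fst z))"
      by (rule continuous_on_compose2[OF cont(1)]) (use e(1) in \<open>auto simp: K_def intro!: continuous_intros\<close>)
    have "\<alpha> (fst z) > 0" if "z \<in> K" for z
      using sol(1,2)[of "fst z"] I(1)[of "fst z" "\<alpha> (fst z)"] that e(1) by (auto simp: K_def)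
    then show ?thesis
      unfolding F_def using ab(1) \<delta>(1)
      by (intro continuous_intros cont_\<mu> cont_\<pi> cont_g * continuous_on_compose2[OF cont_r])
         (auto simp: K_def)
  qed
  \<comment> \<open>The fluxes for which positivity fails somewhere in the middle. This set is
    compact and misses 0, so it misses a neighbourhood of 0.\<close>
  define Z where "Z = fst ` (K \<inter> (\<lambda>z. F (fst z) (snd z)) -` {..0})"
  have "compact K" by (auto simp: K_def intro!: compact_Times)
  then have "compact (K \<inter> (\<lambda>z. F (fst z) (snd z)) -` {..0})"
    using continuous_closed_preimage[OF cont_F compact_imp_closed, of "{..0}"]
    by (metis closed_atMost compact_Int_closed inf.left_idem)
  then have "compact Z"
    unfolding Z_def by (intro compact_continuous_image continuous_intros)
  then have "open (- Z)"
    using compact_imp_closed by blast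
  moreover have "0 \<notin> Z"
  proof
    assume "0 \<in> Z"
    then obtain n where "(0, n) \<in> K" "F 0 n \<le> 0" by (auto simp: Z_def)
    then have "a < n" "n < b" using \<delta>(1) by (auto simp: K_def)
    with pos[of n] \<open>F 0 n \<le> 0\<close> ab(1) show False
      by (simp add: F_def \<open>\<alpha> 0 = a\<close> flux_zero)
  qed
  ultimately obtain e' where e': "e' > 0" "ball 0 e' \<subseteq> - Z"
    using openE[of "- Z" 0] by auto
  define m_bar where "m_bar = min e' (e / 2)"
  have m_bar: "m_bar > 0" using e e' by (simp add: m_bar_def)
  have small: "\<bar>m\<bar> < e" "\<bar>m\<bar> < \<delta>" if "m \<in> {0..<m_bar}" for m
    using that e(1) sol(1)[of m] by (auto simp: m_bar_def)
  have F_pos: "F m n > 0" if m: "m \<in> {0..<m_bar}" and n: "\<alpha> m < n" "n < \<beta> m" for m n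
  proof -
    note s = small[OF m] sol[OF small(1)[OF m]]
    \<comment> \<open>In \<open>I\<close> the function is expanded at \<open>\<alpha> m\<close>, and
      in \<open>J\<close> at \<open>\<beta> m\<close>, where \<mu> and \<pi> take the same values;
      the chord inequalities are exactly its positivity there.\<close>
    consider "n \<in> I" | "n \<in> J" | "n \<in> {a + \<delta>..b - \<delta>}"
      using n s by (force simp: I_def J_def)
    then show ?thesis
    proof cases
      case 1
      then show ?thesis using chord(1)[of m "\<alpha> m" I n] s n
        by (simp add: F_def flux_momentum_def algebra_simps)
    next
      case 2
      then show ?thesis using chord(2)[of m n J "\<beta> m"] s n
        by (simp add: F_def flux_momentum_def algebra_simps)
    next
      case 3
      then have "(m, n) \<in> K" using m by (auto simp: K_def m_bar_def)
      moreover have "m \<in> ball 0 e'" using m by (auto simp: m_bar_def)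
      ultimately show ?thesis using e'(2) by (force simp: subset_iff image_iff Z_def)
    qed
  qed
  show ?thesis
  proof (rule that[OF m_bar])
    have "{0..<m_bar} \<subseteq> {-e<..<e}" using e(1) by (auto simp: m_bar_def)
    with cont show "continuous_on {0..<m_bar} \<alpha>" "continuous_on {0..<m_bar} \<beta>"
      by (auto intro: continuous_on_subset)
    fix m assume m: "m \<in> {0..<m_bar}"
    note s = small[OF m] sol[OF small(1)[OF m]]
    show "0 < \<alpha> m \<and> \<alpha> m < \<beta> m" using I(1)[OF s(2,4)] I_J[OF s(4,5)] by simp
    show "?\<mu> m (\<alpha> m) = ?\<mu> m (\<beta> m)" "?\<pi> m (\<alpha> m) = ?\<pi> m (\<beta> m)" using s by auto
    show "r n - ?\<mu> m (\<alpha> m) * ?g m n + ?\<pi> m (\<alpha> m) > 0" if "\<alpha> m < n" "n < \<beta> m" for n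
      using F_pos[OF m that] by (simp add: F_def)
  qed
qed

section \<open>The family of heteroclinic solutions\<close>

definition flux_state :: "real \<Rightarrow> real \<Rightarrow> state" where
  "flux_state m n = (n, flux_root m n / n, m / n)"

lemma admissible_flux_state: "n > 0 \<Longrightarrow> admissible_state (flux_state m n)"
  using flux_root_pos[of n m]
  by (simp add: admissible_state_def flux_state_def mink_dot_def sum_index4 mink_def planar_def
      flux_root_def field_simps flip: power2_eq_square)

lemma tendsto_flux_state:
  assumes "(f \<longlongrightarrow> n) X" "n > 0"
  shows "((\<lambda>x. flux_state m (f x)) \<longlongrightarrow> flux_state m n) X"
  unfolding flux_state_def flux_root_def using assms(2) by (intro tendsto_intros assms(1)) auto

lemma smooth_flux_root: "smooth_real {0<..} (flux_root m)"
  unfolding flux_root_def[abs_def] power2_eq_square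
  by (intro smooth_real_sqrt smooth_real_add smooth_real_mult smooth_real_ident smooth_real_const)
     (simp add: add_pos_nonneg)

lemma connecting_orbits:
  fixes \<rho> \<kappa> :: "real \<Rightarrow> real \<Rightarrow> real" and s m a b :: real
  defines "r \<equiv> \<lambda>n. \<rho> n s"
  assumes smooth_r: "smooth_real {0<..} r" and smooth_k: "smooth_real {0<..} (\<lambda>n. \<kappa> n s)"
    and k_pos: "\<And>n. n > 0 \<Longrightarrow> \<kappa> n s > 0"
    and ab: "0 < a" "a < b"
    and potential: "flux_potential (deriv r) m a = flux_potential (deriv r) m b"
    and momentum: "flux_momentum r (deriv r) m a = flux_momentum r (deriv r) m b"
    and pos: "\<And>n. a < n \<Longrightarrow> n < b \<Longrightarrow>
      r n - flux_potential (deriv r) m a * flux_root m n + flux_momentum r (deriv r) m a > 0"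
  shows "\<exists>w. heteroclinic \<rho> \<kappa> s (flux_state m a) (flux_state m b) w"
    and "\<exists>w. heteroclinic \<rho> \<kappa> s (flux_state m b) (flux_state m a) w"
proof -
  have sub: "{a..b} \<subseteq> {0<..}" using ab by auto
  define c where "c = flux_potential (deriv r) m a"
  define d where "d = flux_momentum r (deriv r) m a"
  define k where "k n = \<kappa> n s" for n
  define F where "F n = r n - c * flux_root m n + d" for n
  have k: "smooth_real {0<..} k" "\<And>n. n > 0 \<Longrightarrow> k n > 0"
    using smooth_k k_pos by (auto simp: k_def[abs_def])
  have smooth_F: "smooth_real {0<..} F"
    unfolding F_def[abs_def]
    by (intro smooth_real_add smooth_real_diff smooth_real_mult smooth_r smooth_real_const
        smooth_flux_root)
  have F_pos: "F n > 0" if "a < n" "n < b" for n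
    using pos[OF that] by (simp add: F_def c_def d_def)
  have F': "deriv F n = deriv r n - c * (n / flux_root m n)" if "n > 0" for n
    unfolding F_def[abs_def] using that
    by (intro DERIV_imp_deriv)
       (auto intro!: derivative_eq_intros DERIV_flux_root smooth_real_deriv(1)[OF smooth_r])
  have zero: "F z = 0" "deriv F z = 0" if "z = a \<or> z = b" for z
  proof -
    have "z > 0" "c = flux_potential (deriv r) m z" "d = flux_momentum r (deriv r) m z"
      using that ab potential momentum by (auto simp: c_def d_def)
    then show "F z = 0" "deriv F z = 0"
      using F'[of z] flux_root_pos[of z m]
      by (simp_all add: F_def flux_momentum_def flux_potential_def)
  qed
  obtain C where "C \<ge> 0"
    and C: "\<And>z x. z \<in> {a..b} \<Longrightarrow> x \<in> {a..b} \<Longrightarrow> F z = 0 \<Longrightarrow> deriv F z = 0 \<Longrightarrow> F x \<le> C * (x - z)\<^sup>2"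
  proof (rule quadratic_bound[of a b F "deriv F" "deriv (deriv F)"])
    have "smooth_real {0<..} (deriv (deriv F))"
      by (intro smooth_real_deriv(2) smooth_F open_greaterThan)
    then show "continuous_on {a..b} (deriv (deriv F))"
      using continuous_on_subset[OF smooth_real_continuous_on sub] by blast
  qed (use ab smooth_F in \<open>auto intro!: smooth_real_deriv[where S = "{0<..}"]\<close>)
  obtain k0 where k0: "k0 > 0" "\<And>n. n \<in> {a..b} \<Longrightarrow> k n \<ge> k0"
  proof -
    have "continuous_on {a..b} k"
      using continuous_on_subset[OF smooth_real_continuous_on[OF k(1)] sub] .
    then obtain n0 where "n0 \<in> {a..b}" "\<forall>n\<in>{a..b}. k n0 \<le> k n"
      using continuous_attains_inf[of "{a..b}" k] ab by auto
    with k(2)[of n0] ab that[of "k n0"] show ?thesis by auto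
  qed
  \<comment> \<open>The speed \<open>n'\<close> of the increasing orbit, solved from the energy
    equation.\<close>
  define \<phi> where "\<phi> n = sqrt (2 * F n / k n)" for n
  have smooth_\<phi>: "smooth_real {a<..<b} \<phi>"
    unfolding \<phi>_def[abs_def]
  proof (intro smooth_real_sqrt smooth_real_divide smooth_real_mult smooth_real_const)
    show "smooth_real {a<..<b} F" "smooth_real {a<..<b} k"
      using ab by (auto intro!: smooth_real_subset[OF smooth_F] smooth_real_subset[OF k(1)])
  qed (use F_pos k(2) ab in auto)
  have \<phi>_pos: "\<phi> n > 0" if "a < n" "n < b" for n
    using F_pos[OF that] k(2)[of n] that ab by (simp add: \<phi>_def)
  have \<phi>_bound: "\<phi> n \<le> sqrt (2 * C / k0) * \<bar>n - z\<bar>" if "a < n" "n < b" "z = a \<or> z = b" for n z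
  proof -
    have "2 * F n / k n \<le> 2 * (C * (n - z)\<^sup>2) / k0"
      using C[of z n] zero[OF that(3)] F_pos[OF that(1,2)] k0 that ab
      by (intro frac_le) auto
    then have "\<phi> n \<le> sqrt (2 * C / k0 * (n - z)\<^sup>2)"
      unfolding \<phi>_def by (intro real_sqrt_le_mono) simp
    then show ?thesis by (simp only: real_sqrt_mult real_sqrt_abs)
  qed
  have \<phi>_le: "\<phi> n \<le> sqrt (2 * C / k0) * (n - a)" "\<phi> n \<le> sqrt (2 * C / k0) * (b - n)"
    if "a < n" "n < b" for n
    using \<phi>_bound[OF that, of a] \<phi>_bound[OF that, of b] that by simp_all
  obtain N where N: "smooth_real UNIV N" "\<And>t. a < N t \<and> N t < b"
    "\<And>t. (N has_real_derivative \<phi> (N t)) (at t)"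
    "(N \<longlongrightarrow> a) at_bot" "(N \<longlongrightarrow> b) at_top"
    using heteroclinic_ode_solution[OF ab(2) smooth_\<phi> \<phi>_pos \<phi>_le] by blast
  have energy: "k n * (\<phi> n)\<^sup>2 / 2 = F n" if "a < n" "n < b" for n
    using F_pos[OF that] k(2)[of n] that ab by (simp add: \<phi>_def)
  have d\<phi>: "(\<phi> has_real_derivative deriv \<phi> n) (at n)" if "a < n" "n < b" for n
    using smooth_real_deriv(1)[OF smooth_\<phi>] that by simp
  \<comment> \<open>The energy identity is differentiated in the density rather than along the
    orbit: with \<open>n' = \<phi> n\<close> one has \<open>n'' = deriv \<phi> n * \<phi> n\<close>,
    and no division by \<open>n'\<close> occurs.\<close>
  have second: "k n * (deriv \<phi> n * \<phi> n) + deriv k n * (\<phi> n)\<^sup>2 / 2 = deriv F n" if n: "a < n" "n < b" for n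
  proof -
    have "((\<lambda>n. k n * (\<phi> n)\<^sup>2 / 2) has_real_derivative
        k n * (deriv \<phi> n * \<phi> n) + deriv k n * (\<phi> n)\<^sup>2 / 2) (at n)"
      using n ab by (auto intro!: derivative_eq_intros d\<phi> smooth_real_deriv(1)[OF k(1)])
    moreover have "\<forall>\<^sub>F x in nhds n. k x * (\<phi> x)\<^sup>2 / 2 = F x"
      using eventually_nhds_in_open[of "{a<..<b}" n] n energy by (auto elim!: eventually_mono)
    ultimately have "(F has_real_derivative
        k n * (deriv \<phi> n * \<phi> n) + deriv k n * (\<phi> n)\<^sup>2 / 2) (at n)"
      using DERIV_cong_ev[OF refl _ refl, of "\<lambda>x. k x * (\<phi> x)\<^sup>2 / 2" F] by simp
    then show ?thesis by (simp add: DERIV_imp_deriv)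
  qed
  \<comment> \<open>The sign \<sigma> covers both directions: first derivatives enter the equations
    squared, and second derivatives pick up \<open>\<sigma>\<^sup>2 = 1\<close>. The reflection
    reverses the density profile but keeps \<open>m\<close>, hence the direction of the
    flow.\<close>
  have solution: "euler_korteweg_solution \<rho> \<kappa> (\<lambda>x. N (\<sigma> * x $ 1)) (\<lambda>x. s)
      (\<lambda>x. planar (flux_root m (N (\<sigma> * x $ 1)) / N (\<sigma> * x $ 1)) (m / N (\<sigma> * x $ 1)))"
    if \<sigma>: "\<sigma>\<^sup>2 = 1" for \<sigma>
    unfolding flux_root_def
  proof (rule profile_solves_euler_korteweg[where N = "\<lambda>t. N (\<sigma> * t)" and
        ?N1.0 = "\<lambda>t. \<sigma> * \<phi> (N (\<sigma> * t))" and ?N2.0 = "\<lambda>t. deriv \<phi> (N (\<sigma> * t)) * \<phi> (N (\<sigma> * t))"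
        and c = c and d = d])
    show "smooth_real {0<..} (\<lambda>n. \<rho> n s)" using smooth_r by (simp add: r_def)
    show "smooth_real {0<..} (\<lambda>n. \<kappa> n s)" by fact
    show "smooth_real UNIV (\<lambda>t. N (\<sigma> * t))"
      by (rule smooth_real_compose[OF N(1)])
         (auto intro!: smooth_real_mult smooth_real_const smooth_real_ident)
    show N_pos: "N (\<sigma> * t) > 0" for t using N(2)[of "\<sigma> * t"] ab by simp
    have lin: "((\<lambda>t. \<sigma> * t) has_real_derivative \<sigma>) (at t)" for t
      by (auto intro!: derivative_eq_intros)
    show dN: "((\<lambda>t. N (\<sigma> * t)) has_real_derivative \<sigma> * \<phi> (N (\<sigma> * t))) (at t)" for t
      using DERIV_chain2[OF N(3) lin] by (rule DERIV_cong) (rule mult.commute)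
    show "((\<lambda>t. \<sigma> * \<phi> (N (\<sigma> * t))) has_real_derivative
        deriv \<phi> (N (\<sigma> * t)) * \<phi> (N (\<sigma> * t))) (at t)" for t
    proof -
      have "\<sigma> * (x * (\<sigma> * y)) = x * y" for x y
      proof -
        have "\<sigma> * (x * (\<sigma> * y)) = \<sigma>\<^sup>2 * (x * y)" by (simp add: power2_eq_square)
        with \<sigma> show ?thesis by simp
      qed
      with DERIV_cmult[OF DERIV_chain2[OF d\<phi>[OF conjunct1[OF N(2)] conjunct2[OF N(2)]] dN], of \<sigma> t]
      show ?thesis by simp
    qed
    show "\<kappa> (N (\<sigma> * t)) s * (\<sigma> * \<phi> (N (\<sigma> * t)))\<^sup>2 / 2
        = \<rho> (N (\<sigma> * t)) s - c * sqrt ((N (\<sigma> * t))\<^sup>2 + m\<^sup>2) + d" for t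
      using energy[of "N (\<sigma> * t)"] N(2)[of "\<sigma> * t"] \<sigma>
      by (simp add: power_mult_distrib k_def F_def r_def flux_root_def)
    show "\<kappa> (N (\<sigma> * t)) s * (deriv \<phi> (N (\<sigma> * t)) * \<phi> (N (\<sigma> * t)))
        + deriv (\<lambda>n. \<kappa> n s) (N (\<sigma> * t)) * (\<sigma> * \<phi> (N (\<sigma> * t)))\<^sup>2 / 2
        = deriv (\<lambda>n. \<rho> n s) (N (\<sigma> * t)) - c * N (\<sigma> * t) / sqrt ((N (\<sigma> * t))\<^sup>2 + m\<^sup>2)" for t
      using second[of "N (\<sigma> * t)"] F'[OF N_pos[of t]] N(2)[of "\<sigma> * t"] \<sigma>
      by (simp add: power_mult_distrib k_def[abs_def] r_def[abs_def] flux_root_def)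
  qed
  have distinct: "flux_state m a \<noteq> flux_state m b"
    using ab by (simp add: flux_state_def)
  have "heteroclinic \<rho> \<kappa> s (flux_state m a) (flux_state m b) (\<lambda>t. flux_state m (N t))"
    using solution[of 1] tendsto_flux_state[OF N(4), of m] tendsto_flux_state[OF N(5), of m] ab distinct
    by (simp add: heteroclinic_def flux_state_def)
  then show "\<exists>w. heteroclinic \<rho> \<kappa> s (flux_state m a) (flux_state m b) w" by blast
  have "((\<lambda>t. N (- t)) \<longlongrightarrow> b) at_bot" "((\<lambda>t. N (- t)) \<longlongrightarrow> a) at_top"
    using N(5)[unfolded filterlim_at_top_mirror] N(4)[unfolded filterlim_at_bot_mirror] .
  then have "heteroclinic \<rho> \<kappa> s (flux_state m b) (flux_state m a) (\<lambda>t. flux_state m (N (- t)))"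
    using solution[of "-1"] tendsto_flux_state[of "\<lambda>t. N (- t)" b at_bot m]
      tendsto_flux_state[of "\<lambda>t. N (- t)" a at_top m] ab distinct
    by (simp add: heteroclinic_def flux_state_def)
  then show "\<exists>w. heteroclinic \<rho> \<kappa> s (flux_state m b) (flux_state m a) w" by blast
qed

theorem theorem5p1:
  fixes \<rho> \<kappa> :: "real \<Rightarrow> real \<Rightarrow> real" and s_star :: real
  assumes smooth_energy: "smooth_on ({0<..} \<times> UNIV) (\<lambda>(n, s). \<rho> n s)"
    and smooth_capillarity: "smooth_on ({0<..} \<times> UNIV) (\<lambda>(n, s). \<kappa> n s)"
    and capillarity_pos: "\<And>n s. n > 0 \<Longrightarrow> \<kappa> n s > 0"
    and vdW: "van_der_Waals_type \<rho> s_star"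
    and recovers: "pressure_recovers \<rho> s_star"
  shows "\<exists>(m_bar::real) (lower :: real \<Rightarrow> state) (upper :: real \<Rightarrow> state).
     m_bar > 0 \<and>
     continuous_on {0..<m_bar} (\<lambda>m. (lower m, upper m)) \<and>
     inj_on (\<lambda>m. (lower m, upper m)) {0..<m_bar} \<and>
     (\<forall>m\<in>{0..<m_bar}.
        admissible_state (lower m) \<and> admissible_state (upper m) \<and> lower m \<noteq> upper m \<and>
        (\<exists>w_right. heteroclinic \<rho> \<kappa> s_star (lower m) (upper m) w_right) \<and>
        (\<exists>w_left. heteroclinic \<rho> \<kappa> s_star (upper m) (lower m) w_left))"
proof -
  define r where "r n = \<rho> n s_star" for n
  define p where "p n = n * deriv r n - r n" for n
  have smooth_r: "smooth_real {0<..} r" and smooth_k: "smooth_real {0<..} (\<lambda>n. \<kappa> n s_star)"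
    using smooth_real_section[OF smooth_energy] smooth_real_section[OF smooth_capillarity]
    by (auto simp: r_def[abs_def])
  have smooth_r': "smooth_real {0<..} (deriv r)"
    using smooth_real_deriv(2)[OF smooth_r] by simp
  have r: "(r has_real_derivative deriv r n) (at n)"
    "(deriv r has_real_derivative deriv (deriv r) n) (at n)" if "n > 0" for n
    using smooth_real_deriv(1)[OF smooth_r] smooth_real_deriv(1)[OF smooth_r'] that by auto
  have p_pressure: "pressure \<rho> n s_star = p n" for n
    by (simp add: pressure_def p_def r_def[abs_def])
  obtain A B where AB: "0 < A" "A < B" "\<And>n. 0 < n \<Longrightarrow> n < A \<Longrightarrow> deriv (deriv r) n > 0"
    "\<And>n. A < n \<Longrightarrow> n < B \<Longrightarrow> deriv (deriv r) n < 0" "\<And>n. B < n \<Longrightarrow> deriv (deriv r) n > 0"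
    and "\<And>n. n > 0 \<Longrightarrow> r n > 0 \<and> n * deriv r n > r n"
    using vdW unfolding van_der_Waals_type_def Let_def r_def[abs_def] by blast
  then have r_pos: "r n > 0" and p_pos: "p n > 0" if "n > 0" for n
    using that by (auto simp: p_def)
  obtain M where "\<And>n. n > 0 \<Longrightarrow> deriv (deriv r) n < 0 \<Longrightarrow> n < M \<and> p n \<le> p M"
    using recovers unfolding pressure_recovers_def p_pressure r_def[abs_def] by blast
  with AB have M: "\<And>n. A < n \<Longrightarrow> n < B \<Longrightarrow> n < M \<and> p n \<le> p M" by force
  have "\<exists>a b. 0 < a \<and> a < A \<and> B < b \<and> deriv r a = deriv r b \<and> p a = p b \<and>
      (\<forall>n. a < n \<longrightarrow> n < b \<longrightarrow> r n - deriv r a * n + p a > 0)"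
  proof (rule maxwell_construction[of r "deriv r" "deriv (deriv r)" p A B M])
    show "p n = n * deriv r n - r n" for n by (fact p_def)
  qed (fact r r_pos p_pos AB M | blast)+
  then obtain a b where ab: "0 < a" "a < A" "B < b" "deriv r a = deriv r b" "p a = p b"
    and between: "\<And>n. a < n \<Longrightarrow> n < b \<Longrightarrow> r n - deriv r a * n + p a > 0"
    by blast
  have cont_r'': "continuous_on {0<..} (deriv (deriv r))"
    using smooth_real_continuous_on[OF smooth_real_deriv(2)[OF smooth_r']] by simp
  have ab': "a < b" "deriv (deriv r) a > 0" "deriv (deriv r) b > 0"
    using ab AB by auto
  have "\<exists>m_bar \<alpha> \<beta>. m_bar > 0 \<and> continuous_on {0..<m_bar} \<alpha> \<and> continuous_on {0..<m_bar} \<beta> \<and>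
      (\<forall>m\<in>{0..<m_bar}. 0 < \<alpha> m \<and> \<alpha> m < \<beta> m \<and>
        flux_potential (deriv r) m (\<alpha> m) = flux_potential (deriv r) m (\<beta> m) \<and>
        flux_momentum r (deriv r) m (\<alpha> m) = flux_momentum r (deriv r) m (\<beta> m) \<and>
        (\<forall>n. \<alpha> m < n \<longrightarrow> n < \<beta> m \<longrightarrow>
          r n - flux_potential (deriv r) m (\<alpha> m) * flux_root m n + flux_momentum r (deriv r) m (\<alpha> m) > 0))"
  proof (rule maxwell_perturbation[of r "deriv r" "deriv (deriv r)" a b])
    show "a * deriv r a - r a = b * deriv r b - r b"
      using ab by (auto simp: p_def)
    show "r n - deriv r a * n + (a * deriv r a - r a) > 0" if "a < n" "n < b" for n
      using between[OF that] by (simp add: p_def)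
  qed (fact r cont_r'' ab ab' | blast)+
  then obtain m_bar \<alpha> \<beta> where m_bar: "m_bar > 0"
    and cont: "continuous_on {0..<m_bar} \<alpha>" "continuous_on {0..<m_bar} \<beta>"
    and order: "\<And>m. m \<in> {0..<m_bar} \<Longrightarrow> 0 < \<alpha> m \<and> \<alpha> m < \<beta> m"
    and sol: "\<And>m. m \<in> {0..<m_bar} \<Longrightarrow>
        flux_potential (deriv r) m (\<alpha> m) = flux_potential (deriv r) m (\<beta> m)"
      "\<And>m. m \<in> {0..<m_bar} \<Longrightarrow>
        flux_momentum r (deriv r) m (\<alpha> m) = flux_momentum r (deriv r) m (\<beta> m)"
      "\<And>m n. m \<in> {0..<m_bar} \<Longrightarrow> \<alpha> m < n \<Longrightarrow> n < \<beta> m \<Longrightarrow>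
        r n - flux_potential (deriv r) m (\<alpha> m) * flux_root m n + flux_momentum r (deriv r) m (\<alpha> m) > 0"
    by blast
  define lower where "lower m = flux_state m (\<alpha> m)" for m
  define upper where "upper m = flux_state m (\<beta> m)" for m
  have "continuous_on {0..<m_bar} (\<lambda>m. (lower m, upper m))"
    unfolding lower_def upper_def flux_state_def flux_root_def using order
    by (intro continuous_intros cont) force+
  moreover have "inj_on (\<lambda>m. (lower m, upper m)) {0..<m_bar}"
  proof (rule inj_onI)
    fix m m' assume m: "m \<in> {0..<m_bar}" "(lower m, upper m) = (lower m', upper m')"
    \<comment> \<open>The flux is the product of the density and \<open>U\<^sup>1\<close>, so the
      lower state alone already determines the parameter.\<close>
    then have "\<alpha> m = \<alpha> m'" "m / \<alpha> m = m' / \<alpha> m'" by (auto simp: lower_def flux_state_def)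
    with order[OF m(1)] show "m = m'" by simp
  qed
  moreover have "admissible_state (lower m)" "admissible_state (upper m)" "lower m \<noteq> upper m"
    "\<exists>w. heteroclinic \<rho> \<kappa> s_star (lower m) (upper m) w"
    "\<exists>w. heteroclinic \<rho> \<kappa> s_star (upper m) (lower m) w" if m: "m \<in> {0..<m_bar}" for m
  proof -
    show "admissible_state (lower m)" "admissible_state (upper m)"
      using order[OF m] by (auto simp: lower_def upper_def intro!: admissible_flux_state)
    show "lower m \<noteq> upper m"
      using order[OF m] by (simp add: lower_def upper_def flux_state_def)
    show "\<exists>w. heteroclinic \<rho> \<kappa> s_star (lower m) (upper m) w"
      "\<exists>w. heteroclinic \<rho> \<kappa> s_star (upper m) (lower m) w"
      unfolding lower_def upper_def
      using connecting_orbits[of \<rho> s_star \<kappa> "\<alpha> m" "\<beta> m" m] smooth_r smooth_k capillarity_pos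
        order[OF m] sol[OF m]
      unfolding r_def[abs_def] by blast+
  qed
  ultimately show ?thesis using m_bar by blast
qed

end
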